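(* Let $H$ be a group with trivial center and with no epimorphisms onto $\mathbb{Z}$, let $\phi\in\operatorname{Aut}(H)$, and let $H_{\phi}=H\rtimes_{\phi}\mathbb{Z}$ be the associated mapping torus. Then \[ \operatorname{Out}^0(H_{\phi})\cong \frac{C_{\operatorname{Out}(H)}(\widehat{\phi})}{\langle\widehat{\phi}\rangle}, \] where either $\operatorname{Out}^0(H_{\phi})=\operatorname{Out}(H_{\phi})$, or $\widehat{\phi}$ is conjugate to $\widehat{\phi}^{-1}$ in $\operatorname{Out}(H)$, in which case $\operatorname{Out}^0(H_{\phi})$ has index two in $\operatorname{Out}(H_{\phi})$.
   Context: For a group $H$ and $\phi\in\operatorname{Aut}(H)$, the mapping torus is $H_{\phi}=H\rtimes_{\phi}\mathbb{Z}=\langle H,t;\ tht^{-1}=\phi(h),\ h\in H\rangle$. For a group $K$ and $\psi\in\operatorname{Aut}(K)$, $\widehat{\psi}$ denotes the element of $\operatorname{Out}(K)$ represented by $\psi$; $C_K(g)$ denotes the centraliser of $g$ in $K$. Conventions: products of automorphisms are composed left to right, i.e. $\delta\phi(h)$ means $\phi(\delta(h))$; $[x,y]=x^{-1}y^{-1}xy$; $\gamma_g$ is the inner automorphism $\gamma_g(x)=g^{-1}xg$. For $\delta\in\operatorname{Aut}(H)$ with $\widehat{\delta}\in C_{\operatorname{Out}(H)}(\widehat{\phi})$, let $\alpha_{\delta}$ be the automorphism of $H_{\phi}$ given by $h\mapsto\delta(h)$ for all $h\in H$ and $t\mapsto gt$, where $g\in H$ is such that $[\delta,\phi]=\gamma_g$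 in $\operatorname{Aut}(H)$. $\operatorname{Out}^0(H_{\phi})$ is the subgroup of $\operatorname{Out}(H_{\phi})$ consisting of the elements of the form $\widehat{\alpha}_{\delta}$. *)

theory Defs
  imports "HOL-Algebra.Algebra"
begin

section \<open>Automorphisms and outer automorphisms\<close>

text \<open>Automorphisms are composed from left to right, so the group of automorphisms is the
  opposite of the library's \<open>AutoGroup\<close>; its elements are extensional functions.\<close>

definition Aut :: "('a, 'b) monoid_scheme \<Rightarrow> ('a \<Rightarrow> 'a) monoid" where
  "Aut G = (AutoGroup G)\<lparr>monoid.mult := \<lambda>\<delta> \<phi>. \<phi> \<otimes>\<^bsub>AutoGroup G\<^esub> \<delta>\<rparr>"

definition inner_aut :: "('a, 'b) monoid_scheme \<Rightarrow> 'a \<Rightarrow> 'a \<Rightarrow> 'a" where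
  "inner_aut G g = (\<lambda>x\<in>carrier G. inv\<^bsub>G\<^esub> g \<otimes>\<^bsub>G\<^esub> x \<otimes>\<^bsub>G\<^esub> g)"

definition Inn :: "('a, 'b) monoid_scheme \<Rightarrow> ('a \<Rightarrow> 'a) set" where
  "Inn G = inner_aut G ` carrier G"

definition Out :: "('a, 'b) monoid_scheme \<Rightarrow> ('a \<Rightarrow> 'a) set monoid" where
  "Out G = Aut G Mod Inn G"

definition out_class :: "('a, 'b) monoid_scheme \<Rightarrow> ('a \<Rightarrow> 'a) \<Rightarrow> ('a \<Rightarrow> 'a) set" where
  "out_class G \<psi> = Inn G #>\<^bsub>Aut G\<^esub> \<psi>"

definition centre :: "('a, 'b) monoid_scheme \<Rightarrow> 'a set" where
  "centre G = {z \<in> carrier G. \<forall>x\<in>carrier G. z \<otimes>\<^bsub>G\<^esub> x = x \<otimes>\<^bsub>G\<^esub> z}"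

definition centraliser :: "('a, 'b) monoid_scheme \<Rightarrow> 'a \<Rightarrow> 'a set" where
  "centraliser G g = {x \<in> carrier G. x \<otimes>\<^bsub>G\<^esub> g = g \<otimes>\<^bsub>G\<^esub> x}"

definition commutator :: "('a, 'b) monoid_scheme \<Rightarrow> 'a \<Rightarrow> 'a \<Rightarrow> 'a" where
  "commutator G x y = inv\<^bsub>G\<^esub> x \<otimes>\<^bsub>G\<^esub> inv\<^bsub>G\<^esub> y \<otimes>\<^bsub>G\<^esub> x \<otimes>\<^bsub>G\<^esub> y"

definition conjugate_in :: "('a, 'b) monoid_scheme \<Rightarrow> 'a \<Rightarrow> 'a \<Rightarrow> bool" where
  "conjugate_in G x y \<longleftrightarrow> (\<exists>z\<in>carrier G. inv\<^bsub>G\<^esub> z \<otimes>\<^bsub>G\<^esub> x \<otimes>\<^bsub>G\<^esub> z = y)"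


section \<open>Mapping tori\<close>

text \<open>The pair \<open>(h, m)\<close> stands for \<open>h t\<^sup>m\<close>; hence \<open>H\<close> is embedded by \<open>h \<mapsto> (h, 0)\<close>, the stable letter \<open>t\<close>
  is \<open>(\<one>, 1)\<close>, and \<open>t\<^sup>m k = \<phi>\<^sup>m(k) t\<^sup>m\<close> gives the multiplication.\<close>

definition mapping_torus :: "('a, 'b) monoid_scheme \<Rightarrow> ('a \<Rightarrow> 'a) \<Rightarrow> ('a \<times> int) monoid" where
  "mapping_torus H \<phi> =
    \<lparr>carrier = carrier H \<times> UNIV,
     monoid.mult = \<lambda>(h, m) (k, n). (h \<otimes>\<^bsub>H\<^esub> (\<phi> [^]\<^bsub>Aut H\<^esub> m) k, m + n),
     one = (\<one>\<^bsub>H\<^esub>, 0)\<rparr>"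

text \<open>\<open>is_alpha H \<phi> \<delta> \<alpha>\<close> says that \<open>\<alpha>\<close> is the automorphism \<open>h \<mapsto> \<delta>(h)\<close>, \<open>t \<mapsto> g t\<close> of the mapping torus,
  where \<open>[\<delta>, \<phi>] = \<gamma>\<^sub>g\<close>. If \<open>H\<close> has trivial centre, \<open>g\<close> and hence \<open>\<alpha>\<close> are determined by
  \<open>\<delta>\<close>; see \<open>is_alpha_ex1\<close> below.\<close>

definition is_alpha ::
  "('a, 'b) monoid_scheme \<Rightarrow> ('a \<Rightarrow> 'a) \<Rightarrow> ('a \<Rightarrow> 'a) \<Rightarrow> ('a \<times> int \<Rightarrow> 'a \<times> int) \<Rightarrow> bool" where
  "is_alpha H \<phi> \<delta> \<alpha> \<longleftrightarrow>
    \<alpha> \<in> carrier (Aut (mapping_torus H \<phi>)) \<and>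
    (\<exists>g\<in>carrier H. commutator (Aut H) \<delta> \<phi> = inner_aut H g \<and>
      (\<forall>h\<in>carrier H. \<alpha> (h, 0) = (\<delta> h, 0)) \<and>
      \<alpha> (\<one>\<^bsub>H\<^esub>, 1) = (g, 0) \<otimes>\<^bsub>mapping_torus H \<phi>\<^esub> (\<one>\<^bsub>H\<^esub>, 1))"

definition Out0 :: "('a, 'b) monoid_scheme \<Rightarrow> ('a \<Rightarrow> 'a) \<Rightarrow> ('a \<times> int \<Rightarrow> 'a \<times> int) set set" where
  "Out0 H \<phi> =
    {out_class (mapping_torus H \<phi>) \<alpha> |\<alpha> \<delta>.
      \<delta> \<in> carrier (Aut H) \<and>
      out_class H \<delta> \<in> centraliser (Out H) (out_class H \<phi>) \<and>
      is_alpha H \<phi> \<delta> \<alpha>}"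


section \<open>Well-definedness\<close>

lemma carrier_Aut: "carrier (Aut G) = auto G"
  by (simp add: Aut_def AutoGroup_def)

lemma one_Aut: "\<one>\<^bsub>Aut G\<^esub> = (\<lambda>x\<in>carrier G. x)"
  by (simp add: Aut_def AutoGroup_def BijGroup_def)

lemma mult_Aut:
  "\<delta> \<in> carrier (Aut G) \<Longrightarrow> \<phi> \<in> carrier (Aut G) \<Longrightarrow> \<delta> \<otimes>\<^bsub>Aut G\<^esub> \<phi> = compose (carrier G) \<phi> \<delta>"
  by (simp add: carrier_Aut) (simp add: Aut_def AutoGroup_def BijGroup_def auto_def)

lemma mult_Aut_apply:
  "\<delta> \<in> carrier (Aut G) \<Longrightarrow> \<phi> \<in> carrier (Aut G) \<Longrightarrow> x \<in> carrier G \<Longrightarrow> (\<delta> \<otimes>\<^bsub>Aut G\<^esub> \<phi>) x = \<phi> (\<delta> x)"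
  by (simp add: mult_Aut compose_def)

lemma Aut_iff:
  "\<phi> \<in> carrier (Aut G) \<longleftrightarrow>
    \<phi> \<in> hom G G \<and> \<phi> \<in> extensional (carrier G) \<and> bij_betw \<phi> (carrier G) (carrier G)"
  by (auto simp: carrier_Aut auto_def Bij_def)

lemma Aut_closed: "\<phi> \<in> carrier (Aut G) \<Longrightarrow> x \<in> carrier G \<Longrightarrow> \<phi> x \<in> carrier G"
  by (auto simp: Aut_iff hom_def)

lemma Aut_mult:
  "\<phi> \<in> carrier (Aut G) \<Longrightarrow> x \<in> carrier G \<Longrightarrow> y \<in> carrier G \<Longrightarrow> \<phi> (x \<otimes>\<^bsub>G\<^esub> y) = \<phi> x \<otimes>\<^bsub>G\<^esub> \<phi> y"
  by (auto simp: Aut_iff hom_def)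

lemma Aut_eqI:
  "\<phi> \<in> carrier (Aut G) \<Longrightarrow> \<psi> \<in> carrier (Aut G) \<Longrightarrow> (\<And>x. x \<in> carrier G \<Longrightarrow> \<phi> x = \<psi> x) \<Longrightarrow> \<phi> = \<psi>"
  by (auto simp: Aut_iff intro: extensionalityI)

lemma group_Aut:
  assumes "group G" shows "group (Aut G)"
proof -
  interpret A: group "AutoGroup G" using assms by (rule group.AutoGroup)
  show ?thesis
  proof (rule groupI)
    fix x assume "x \<in> carrier (Aut G)"
    then show "\<exists>y\<in>carrier (Aut G). y \<otimes>\<^bsub>Aut G\<^esub> x = \<one>\<^bsub>Aut G\<^esub>"
      by (auto simp: Aut_def intro!: bexI[of _ "inv\<^bsub>AutoGroup G\<^esub> x"])
  qed (auto simp: Aut_def A.m_assoc)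
qed

lemma Aut_one:
  assumes "group G" "\<phi> \<in> carrier (Aut G)" shows "\<phi> \<one>\<^bsub>G\<^esub> = \<one>\<^bsub>G\<^esub>"
  using assms by (auto simp: Aut_iff intro: hom_one)

lemma Aut_inv:
  assumes "group G" "\<phi> \<in> carrier (Aut G)" "x \<in> carrier G" shows "\<phi> (inv\<^bsub>G\<^esub> x) = inv\<^bsub>G\<^esub> (\<phi> x)"
proof -
  have "group_hom G G \<phi>" using assms by (auto simp: Aut_iff group_hom_def group_hom_axioms_def)
  then show ?thesis using assms(3) by (rule group_hom.hom_inv)
qed

lemma inner_aut_in_Aut:
  assumes "group G" "g \<in> carrier G" shows "inner_aut G g \<in> carrier (Aut G)"
proof -
  interpret group G by fact
  have "bij_betw (inner_aut G g) (carrier G) (carrier G)"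
    by (rule bij_betw_byWitness[where f' = "\<lambda>x. g \<otimes>\<^bsub>G\<^esub> x \<otimes>\<^bsub>G\<^esub> inv\<^bsub>G\<^esub> g"])
      (use assms(2) in \<open>auto simp: inner_aut_def inv_solve_left inv_solve_right simp flip: m_assoc\<close>,
        simp_all add: m_assoc)
  moreover have "inner_aut G g \<in> hom G G"
  proof (rule homI)
    fix x y assume x: "x \<in> carrier G" and y: "y \<in> carrier G"
    have "g \<otimes>\<^bsub>G\<^esub> (inv\<^bsub>G\<^esub> g \<otimes>\<^bsub>G\<^esub> (y \<otimes>\<^bsub>G\<^esub> g)) = y \<otimes>\<^bsub>G\<^esub> g"
      using y assms(2) by (simp flip: m_assoc)
    then show "inner_aut G g (x \<otimes>\<^bsub>G\<^esub> y) = inner_aut G g x \<otimes>\<^bsub>G\<^esub> inner_aut G g y"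
      using x y assms(2) by (simp add: inner_aut_def m_assoc)
  qed (use assms(2) in \<open>simp add: inner_aut_def\<close>)
  ultimately show ?thesis by (simp add: Aut_iff) (simp add: inner_aut_def)
qed

lemma inner_aut_mult:
  assumes "group G" "a \<in> carrier G" "b \<in> carrier G"
  shows "inner_aut G a \<otimes>\<^bsub>Aut G\<^esub> inner_aut G b = inner_aut G (a \<otimes>\<^bsub>G\<^esub> b)"
proof -
  interpret group G by fact
  interpret A: group "Aut G" by (rule group_Aut) fact
  show ?thesis
    by (rule Aut_eqI[where G = G])
      (use assms inner_aut_in_Aut[OF assms(1)] in \<open>auto simp: mult_Aut_apply\<close>,
        use assms in \<open>simp add: inner_aut_def m_assoc inv_mult_group\<close>)
qed

lemma inner_aut_conj:
  assumes "group G" "a \<in> carrier G" "\<psi> \<in> carrier (Aut G)"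
  shows "inv\<^bsub>Aut G\<^esub> \<psi> \<otimes>\<^bsub>Aut G\<^esub> inner_aut G a \<otimes>\<^bsub>Aut G\<^esub> \<psi> = inner_aut G (\<psi> a)"
proof -
  interpret group G by fact
  interpret A: group "Aut G" by (rule group_Aut) fact
  have "inner_aut G a \<otimes>\<^bsub>Aut G\<^esub> \<psi> = \<psi> \<otimes>\<^bsub>Aut G\<^esub> inner_aut G (\<psi> a)"
    by (rule Aut_eqI[where G = G])
      (use assms inner_aut_in_Aut[OF assms(1)] in
        \<open>auto simp: mult_Aut_apply inner_aut_def Aut_closed Aut_mult Aut_inv\<close>)
  then show ?thesis
    using assms inner_aut_in_Aut[OF assms(1)]
    by (simp add: A.m_assoc A.inv_solve_left' Aut_closed)
qed

lemma Inn_normal: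
  assumes "group G" shows "Inn G \<lhd> Aut G"
proof -
  interpret group G by fact
  interpret A: group "Aut G" by (rule group_Aut) fact
  have hom: "group_hom G (Aut G) (inner_aut G)"
    using assms inner_aut_in_Aut[OF assms]
    by (auto simp: group_hom_def group_hom_axioms_def A.is_group hom_def inner_aut_mult)
  have "subgroup (Inn G) (Aut G)"
    unfolding Inn_def by (rule group_hom.img_is_subgroup[OF hom])
  moreover have "x \<otimes>\<^bsub>Aut G\<^esub> h \<otimes>\<^bsub>Aut G\<^esub> inv\<^bsub>Aut G\<^esub> x \<in> Inn G"
    if x: "x \<in> carrier (Aut G)" and h: "h \<in> Inn G" for x h
  proof -
    obtain a where a: "a \<in> carrier G" "h = inner_aut G a" using h by (auto simp: Inn_def)
    show ?thesis
      using inner_aut_conj[OF assms a(1) A.inv_closed[OF x]] a x Aut_closed[OF A.inv_closed[OF x] a(1)]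
      by (simp add: Inn_def)
  qed
  ultimately show ?thesis by (simp add: A.normal_inv_iff)
qed

lemma group_Out: "group G \<Longrightarrow> group (Out G)"
  unfolding Out_def by (intro normal.factorgroup_is_group Inn_normal)

lemma out_class_hom: "group G \<Longrightarrow> group_hom (Aut G) (Out G) (out_class G)"
  using normal.r_coset_hom_Mod[OF Inn_normal, of G] group_Out[of G]
  by (simp add: group_hom_def group_hom_axioms_def group_Aut Out_def out_class_def[abs_def])

context
  fixes H :: "('a, 'b) monoid_scheme" and \<phi> :: "'a \<Rightarrow> 'a"
  assumes H: "group H" and \<phi>: "\<phi> \<in> carrier (Aut H)"
begin

interpretation group H by (rule H)
interpretation A: group "Aut H" by (rule group_Aut[OF H])

abbreviation (input) T where "T \<equiv> mapping_torus H \<phi>"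

lemma pow_Aut: "\<phi> [^]\<^bsub>Aut H\<^esub> (m::int) \<in> carrier (Aut H)"
  using \<phi> by simp

lemma pow_Aut_add:
  "x \<in> carrier H \<Longrightarrow> (\<phi> [^]\<^bsub>Aut H\<^esub> (m + n::int)) x = (\<phi> [^]\<^bsub>Aut H\<^esub> m) ((\<phi> [^]\<^bsub>Aut H\<^esub> n) x)"
  using \<phi> by (simp add: add.commute[of m] A.int_pow_mult mult_Aut_apply)

lemma pow_Aut_0: "x \<in> carrier H \<Longrightarrow> (\<phi> [^]\<^bsub>Aut H\<^esub> (0::int)) x = x"
  by (simp add: one_Aut)

lemma carrier_torus: "carrier T = carrier H \<times> UNIV"
  by (simp add: mapping_torus_def)

lemma mult_torus: "(h, m) \<otimes>\<^bsub>T\<^esub> (k, n) = (h \<otimes>\<^bsub>H\<^esub> (\<phi> [^]\<^bsub>Aut H\<^esub> m) k, m + n)"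
  by (simp add: mapping_torus_def)

lemma one_torus: "\<one>\<^bsub>T\<^esub> = (\<one>\<^bsub>H\<^esub>, 0)"
  by (simp add: mapping_torus_def)

lemma group_mapping_torus: "group T"
proof (rule groupI)
  fix x assume "x \<in> carrier T"
  then obtain h m where x: "x = (h, m)" "h \<in> carrier H" by (auto simp: carrier_torus)
  let ?k = "(\<phi> [^]\<^bsub>Aut H\<^esub> (- m)) (inv\<^bsub>H\<^esub> h)"
  have "(?k, - m) \<otimes>\<^bsub>T\<^esub> x = \<one>\<^bsub>T\<^esub>"
    using x Aut_mult[OF pow_Aut, of "inv\<^bsub>H\<^esub> h" h "- m", symmetric] Aut_one[OF H pow_Aut]
    by (simp add: mult_torus one_torus)
  then show "\<exists>y\<in>carrier T. y \<otimes>\<^bsub>T\<^esub> x = \<one>\<^bsub>T\<^esub>"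
    using x Aut_closed[OF pow_Aut] by (intro bexI[of _ "(?k, - m)"]) (auto simp: carrier_torus)
qed (auto simp: carrier_torus mult_torus one_torus Aut_closed[OF pow_Aut] Aut_mult[OF pow_Aut]
    Aut_one[OF H pow_Aut] pow_Aut_0 pow_Aut_add m_assoc one_Aut)

interpretation T: group T by (rule group_mapping_torus)

lemma torus_pow: "(\<one>\<^bsub>H\<^esub>, 1) [^]\<^bsub>T\<^esub> (m::int) = (\<one>\<^bsub>H\<^esub>, m)"
proof -
  let ?f = "\<lambda>m::int. (\<one>\<^bsub>H\<^esub>, m)"
  have "group_hom integer_group T ?f"
    by (auto simp: group_hom_def group_hom_axioms_def hom_def carrier_torus mult_torus
        T.is_group Aut_one[OF H pow_Aut])
  from group_hom.hom_int_pow[OF this, of 1 m] show ?thesis by simp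
qed

lemma torus_decomp: "h \<in> carrier H \<Longrightarrow> (h, m) = (h, 0) \<otimes>\<^bsub>T\<^esub> (\<one>\<^bsub>H\<^esub>, 1) [^]\<^bsub>T\<^esub> m"
  by (simp add: torus_pow mult_torus one_Aut)

lemma torus_relation:
  "h \<in> carrier H \<Longrightarrow> (\<one>\<^bsub>H\<^esub>, 1) \<otimes>\<^bsub>T\<^esub> (h, 0) \<otimes>\<^bsub>T\<^esub> inv\<^bsub>T\<^esub> (\<one>\<^bsub>H\<^esub>, 1) = (\<phi> h, 0)"
  by (rule T.inv_solve_right'[THEN iffD2]) (use \<phi> in \<open>auto simp: carrier_torus mult_torus Aut_closed one_Aut\<close>)

lemma commutator_iff:
  assumes \<delta>: "\<delta> \<in> carrier (Aut H)" and g: "g \<in> carrier H"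
  shows "commutator (Aut H) \<delta> \<phi> = inner_aut H g \<longleftrightarrow>
    (\<forall>h\<in>carrier H. g \<otimes>\<^bsub>H\<^esub> \<phi> (\<delta> h) = \<delta> (\<phi> h) \<otimes>\<^bsub>H\<^esub> g)"
proof -
  note in_Aut = \<phi> \<delta> inner_aut_in_Aut[OF H g]
  have "commutator (Aut H) \<delta> \<phi> = inner_aut H g \<longleftrightarrow>
      \<delta> \<otimes>\<^bsub>Aut H\<^esub> \<phi> = \<phi> \<otimes>\<^bsub>Aut H\<^esub> \<delta> \<otimes>\<^bsub>Aut H\<^esub> inner_aut H g"
    using in_Aut by (simp add: commutator_def A.m_assoc A.inv_solve_left')
  also have "\<dots> \<longleftrightarrow> (\<forall>h\<in>carrier H. \<phi> (\<delta> h) = inv\<^bsub>H\<^esub> g \<otimes>\<^bsub>H\<^esub> \<delta> (\<phi> h) \<otimes>\<^bsub>H\<^esub> g)" (is "?l = ?r \<longleftrightarrow> _")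
  proof -
    have "?l = ?r \<longleftrightarrow> (\<forall>h\<in>carrier H. ?l h = ?r h)"
      using Aut_eqI[of ?l H ?r] in_Aut by auto
    also have "\<dots> \<longleftrightarrow> (\<forall>h\<in>carrier H. \<phi> (\<delta> h) = inv\<^bsub>H\<^esub> g \<otimes>\<^bsub>H\<^esub> \<delta> (\<phi> h) \<otimes>\<^bsub>H\<^esub> g)"
      using in_Aut by (simp add: mult_Aut_apply Aut_closed) (simp add: inner_aut_def Aut_closed)
    finally show ?thesis .
  qed
  also have "\<dots> \<longleftrightarrow> (\<forall>h\<in>carrier H. g \<otimes>\<^bsub>H\<^esub> \<phi> (\<delta> h) = \<delta> (\<phi> h) \<otimes>\<^bsub>H\<^esub> g)"
    using g \<phi> \<delta> by (intro ball_cong refl) (auto simp: m_assoc inv_solve_left Aut_closed)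
  finally show ?thesis .
qed

lemma is_alpha_ex:
  assumes \<delta>: "\<delta> \<in> carrier (Aut H)" and g: "g \<in> carrier H"
    and comm: "commutator (Aut H) \<delta> \<phi> = inner_aut H g"
  shows "\<exists>\<alpha>. is_alpha H \<phi> \<delta> \<alpha>"
proof -
  let ?t = "(g, 1::int)"
  let ?p = "\<lambda>m::int. ?t [^]\<^bsub>T\<^esub> m"
  let ?f = "\<lambda>m::int. \<phi> [^]\<^bsub>Aut H\<^esub> m"
  have t: "?t \<in> carrier T" using g by (simp add: carrier_torus)
  have f_in: "?f m k \<in> carrier H" if "k \<in> carrier H" for m k
    using Aut_closed[OF pow_Aut that] .
  have in_T: "(\<delta> k, 0) \<in> carrier T" if "k \<in> carrier H" for k
    using \<delta> that by (simp add: carrier_torus Aut_closed)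
  define P where
    "P m \<longleftrightarrow> (\<forall>k\<in>carrier H. ?p m \<otimes>\<^bsub>T\<^esub> (\<delta> k, 0) = (\<delta> (?f m k), 0) \<otimes>\<^bsub>T\<^esub> ?p m)" for m
  have P0: "P 0" using in_T by (simp add: P_def one_Aut)
  have P1: "P 1"
    using comm \<delta> g \<phi>
    by (simp add: P_def t T.int_pow_1 A.int_pow_1 commutator_iff mult_torus one_Aut Aut_closed)
  have P_add: "P (m + n)" if "P m" "P n" for m n
    unfolding P_def
  proof
    fix k assume k: "k \<in> carrier H"
    have "?p (m + n) \<otimes>\<^bsub>T\<^esub> (\<delta> k, 0) = ?p m \<otimes>\<^bsub>T\<^esub> (?p n \<otimes>\<^bsub>T\<^esub> (\<delta> k, 0))"
      using t in_T[OF k] by (simp add: T.int_pow_mult T.m_assoc)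
    also have "\<dots> = ?p m \<otimes>\<^bsub>T\<^esub> (\<delta> (?f n k), 0) \<otimes>\<^bsub>T\<^esub> ?p n"
      using t in_T f_in k \<open>P n\<close> by (simp add: P_def T.m_assoc)
    also have "\<dots> = (\<delta> (?f (m + n) k), 0) \<otimes>\<^bsub>T\<^esub> ?p (m + n)"
      using t in_T f_in k \<open>P m\<close> by (simp add: P_def T.m_assoc T.int_pow_mult pow_Aut_add)
    finally show "?p (m + n) \<otimes>\<^bsub>T\<^esub> (\<delta> k, 0) = (\<delta> (?f (m + n) k), 0) \<otimes>\<^bsub>T\<^esub> ?p (m + n)" .
  qed
  have P_neg: "P (- m)" if "P m" for m
    unfolding P_def
  proof
    fix k assume k: "k \<in> carrier H"
    have "?p m \<otimes>\<^bsub>T\<^esub> (\<delta> (?f (- m) k), 0) = (\<delta> k, 0) \<otimes>\<^bsub>T\<^esub> ?p m"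
      using \<open>P m\<close> f_in[OF k] pow_Aut_add[OF k, of m "- m"] pow_Aut_0[OF k] by (simp add: P_def)
    then show "?p (- m) \<otimes>\<^bsub>T\<^esub> (\<delta> k, 0) = (\<delta> (?f (- m) k), 0) \<otimes>\<^bsub>T\<^esub> ?p (- m)"
      using t in_T[OF k] in_T[OF f_in[OF k], of "- m"]
      by (simp add: T.int_pow_neg T.inv_solve_left' flip: T.m_assoc)
        (simp add: T.m_assoc)
  qed
  have P_nat: "P (int n)" for n
  proof (induction n)
    case (Suc n)
    from P_add[OF P1 this] show ?case by simp
  qed (simp add: P0)
  have P: "P m" for m
    using P_nat P_neg by (cases m rule: int_cases2) auto
  have snd_p: "snd (?p m) = m" for m
  proof -
    have "group_hom T integer_group snd"
      by (auto simp: group_hom_def group_hom_axioms_def hom_def carrier_torus mult_torus T.is_group)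
    from group_hom.hom_int_pow[OF this t, of m] show ?thesis by simp
  qed
  define \<alpha> where "\<alpha> = (\<lambda>(h, m)\<in>carrier T. (\<delta> h, 0) \<otimes>\<^bsub>T\<^esub> ?p m)"
  have \<alpha>: "\<alpha> (h, m) = (\<delta> h, 0) \<otimes>\<^bsub>T\<^esub> ?p m" if "h \<in> carrier H" for h m
    using that by (simp add: \<alpha>_def carrier_torus)
  have snd_mult: "snd (x \<otimes>\<^bsub>T\<^esub> y) = snd x + snd y" for x y
    by (cases x; cases y) (simp add: mult_torus)
  have hom: "\<alpha> \<in> hom T T"
  proof (rule homI)
    fix x assume "x \<in> carrier T"
    then obtain h m where "x = (h, m)" "h \<in> carrier H" by (auto simp: carrier_torus)
    then show "\<alpha> x \<in> carrier T" using in_T t by (simp add: \<alpha>)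
  next
    fix x y assume "x \<in> carrier T" "y \<in> carrier T"
    then obtain h m k n where x: "x = (h, m)" "h \<in> carrier H" and y: "y = (k, n)" "k \<in> carrier H"
      by (auto simp: carrier_torus)
    have "\<alpha> (x \<otimes>\<^bsub>T\<^esub> y) = (\<delta> h \<otimes>\<^bsub>H\<^esub> \<delta> (?f m k), 0) \<otimes>\<^bsub>T\<^esub> ?p (m + n)"
      using x y \<delta> f_in by (simp add: mult_torus \<alpha> Aut_mult)
    also have "(\<delta> h \<otimes>\<^bsub>H\<^esub> \<delta> (?f m k), 0) = (\<delta> h, 0) \<otimes>\<^bsub>T\<^esub> (\<delta> (?f m k), 0)"
      using x y \<delta> f_in by (simp add: mult_torus one_Aut Aut_closed)
    also have "\<dots> \<otimes>\<^bsub>T\<^esub> ?p (m + n) = (\<delta> h, 0) \<otimes>\<^bsub>T\<^esub> ((\<delta> (?f m k), 0) \<otimes>\<^bsub>T\<^esub> ?p m) \<otimes>\<^bsub>T\<^esub> ?p n"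
      using x y in_T f_in t by (simp add: T.int_pow_mult T.m_assoc)
    also have "\<dots> = (\<delta> h, 0) \<otimes>\<^bsub>T\<^esub> (?p m \<otimes>\<^bsub>T\<^esub> (\<delta> k, 0)) \<otimes>\<^bsub>T\<^esub> ?p n"
      using P y by (simp add: P_def)
    also have "\<dots> = \<alpha> x \<otimes>\<^bsub>T\<^esub> \<alpha> y"
      using x y in_T t by (simp add: \<alpha> T.m_assoc)
    finally show "\<alpha> (x \<otimes>\<^bsub>T\<^esub> y) = \<alpha> x \<otimes>\<^bsub>T\<^esub> \<alpha> y" .
  qed
  have inj: "inj_on \<alpha> (carrier T)"
  proof (rule inj_onI)
    fix x y assume "x \<in> carrier T" "y \<in> carrier T" and eq: "\<alpha> x = \<alpha> y"
    then obtain h m k n where x: "x = (h, m)" "h \<in> carrier H" and y: "y = (k, n)" "k \<in> carrier H"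
      by (auto simp: carrier_torus)
    have "m = n" using arg_cong[OF eq, of snd] x y by (simp add: \<alpha> snd_mult snd_p)
    moreover from this have "\<delta> h = \<delta> k" using eq x y in_T t by (simp add: \<alpha>)
    then have "h = k" using \<delta> x y by (auto simp: Aut_iff bij_betw_def dest: inj_onD)
    ultimately show "x = y" using x y by simp
  qed
  have surj: "\<exists>y\<in>carrier T. \<alpha> y = x" if "x \<in> carrier T" for x
  proof -
    let ?z = "x \<otimes>\<^bsub>T\<^esub> ?p (- snd x)"
    have z: "?z \<in> carrier T" "snd ?z = 0" using that t by (simp_all add: snd_mult snd_p)
    then obtain y where y: "?z = (y, 0)" "y \<in> carrier H"
      by (cases ?z) (auto simp: carrier_torus)
    then obtain h where h: "h \<in> carrier H" "\<delta> h = y"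
      using \<delta> by (metis Aut_iff bij_betw_def imageE)
    have "\<alpha> (h, snd x) = ?z \<otimes>\<^bsub>T\<^esub> ?p (snd x)" using h y by (simp add: \<alpha>)
    also have "\<dots> = x" using that t by (simp add: T.int_pow_neg T.m_assoc)
    finally show ?thesis using h by (auto simp: carrier_torus)
  qed
  have ext: "\<alpha> \<in> extensional (carrier T)" by (simp add: \<alpha>_def)
  have img: "\<alpha> ` carrier T = carrier T"
  proof (rule equalityI)
    show "\<alpha> ` carrier T \<subseteq> carrier T" by (rule hom_carrier[OF hom])
    show "carrier T \<subseteq> \<alpha> ` carrier T"
    proof
      fix x assume "x \<in> carrier T"
      then obtain y where "y \<in> carrier T" "\<alpha> y = x" using surj by blast
      then show "x \<in> \<alpha> ` carrier T" by (rule rev_image_eqI[OF _ sym])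
    qed
  qed
  have "\<alpha> \<in> carrier (Aut T)"
    by (simp add: Aut_iff bij_betw_def hom ext inj img)
  then show ?thesis
    unfolding is_alpha_def using g comm \<delta> t Aut_one[OF H \<delta>] in_T
    by (intro exI[of _ \<alpha>] conjI bexI[of _ g])
      (auto simp: \<alpha> mult_torus one_Aut)
qed

lemma inner_aut_inj:
  assumes "centre H = {\<one>\<^bsub>H\<^esub>}" "a \<in> carrier H" "b \<in> carrier H" "inner_aut H a = inner_aut H b"
  shows "a = b"
proof -
  have "a \<otimes>\<^bsub>H\<^esub> inv\<^bsub>H\<^esub> b \<in> centre H"
    unfolding centre_def
  proof (intro CollectI conjI ballI)
    fix x assume x: "x \<in> carrier H"
    have "inv\<^bsub>H\<^esub> a \<otimes>\<^bsub>H\<^esub> (x \<otimes>\<^bsub>H\<^esub> a) = inv\<^bsub>H\<^esub> b \<otimes>\<^bsub>H\<^esub> x \<otimes>\<^bsub>H\<^esub> b"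
      using fun_cong[OF assms(4), of x] assms(2,3) x by (simp add: inner_aut_def m_assoc)
    then have "x \<otimes>\<^bsub>H\<^esub> a = a \<otimes>\<^bsub>H\<^esub> (inv\<^bsub>H\<^esub> b \<otimes>\<^bsub>H\<^esub> x \<otimes>\<^bsub>H\<^esub> b)"
      using assms(2,3) x by (simp add: inv_solve_left')
    then have "x \<otimes>\<^bsub>H\<^esub> a \<otimes>\<^bsub>H\<^esub> inv\<^bsub>H\<^esub> b = a \<otimes>\<^bsub>H\<^esub> inv\<^bsub>H\<^esub> b \<otimes>\<^bsub>H\<^esub> x"
      using assms(2,3) x by (simp add: m_assoc)
    then show "a \<otimes>\<^bsub>H\<^esub> inv\<^bsub>H\<^esub> b \<otimes>\<^bsub>H\<^esub> x = x \<otimes>\<^bsub>H\<^esub> (a \<otimes>\<^bsub>H\<^esub> inv\<^bsub>H\<^esub> b)"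
      using assms(2,3) x by (simp add: m_assoc)
  qed (use assms in simp)
  then show ?thesis using assms by (simp add: inv_solve_right')
qed

lemma out_class_eq_one:
  assumes "g \<in> carrier H" shows "out_class H (inner_aut H g) = \<one>\<^bsub>Out H\<^esub>"
proof -
  interpret N: normal "Inn H" "Aut H" by (rule Inn_normal[OF H])
  have "inner_aut H g \<in> Inn H" using assms by (simp add: Inn_def)
  then show ?thesis
    by (simp add: out_class_def Out_def FactGroup_def N.rcos_const[OF A.is_group])
qed

lemma out_class_eq_oneD:
  assumes "\<delta> \<in> carrier (Aut H)" "out_class H \<delta> = \<one>\<^bsub>Out H\<^esub>"
  shows "\<exists>g\<in>carrier H. \<delta> = inner_aut H g"
proof -
  interpret N: normal "Inn H" "Aut H" by (rule Inn_normal[OF H])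
  have "\<delta> \<in> Inn H"
    using assms A.rcos_self[OF assms(1) N.subgroup_axioms]
    by (simp add: out_class_def Out_def FactGroup_def)
  then show ?thesis by (auto simp: Inn_def)
qed

lemma centraliser_iff:
  assumes \<delta>: "\<delta> \<in> carrier (Aut H)"
  shows "out_class H \<delta> \<in> centraliser (Out H) (out_class H \<phi>) \<longleftrightarrow>
    (\<exists>g\<in>carrier H. commutator (Aut H) \<delta> \<phi> = inner_aut H g)"
proof -
  interpret c: group_hom "Aut H" "Out H" "out_class H" by (rule out_class_hom[OF H])
  have "out_class H \<delta> \<in> centraliser (Out H) (out_class H \<phi>) \<longleftrightarrow>
      out_class H (commutator (Aut H) \<delta> \<phi>) = \<one>\<^bsub>Out H\<^esub>"
    using \<delta> \<phi> by (simp add: centraliser_def commutator_def c.H.m_assoc c.H.inv_solve_left')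
  moreover have "commutator (Aut H) \<delta> \<phi> \<in> carrier (Aut H)"
    using \<delta> \<phi> by (simp add: commutator_def)
  ultimately show ?thesis using out_class_eq_one out_class_eq_oneD by metis
qed

lemma is_alphaD:
  assumes "is_alpha H \<phi> \<delta> \<alpha>"
  obtains g where "\<alpha> \<in> carrier (Aut T)" "g \<in> carrier H"
    "\<And>h. h \<in> carrier H \<Longrightarrow> \<alpha> (h, 0) = (\<delta> h, 0)" "\<alpha> (\<one>\<^bsub>H\<^esub>, 1) = (g, 1)"
  using assms unfolding is_alpha_def by (auto simp: mult_torus one_Aut)

lemma is_alpha_ex1:
  assumes "centre H = {\<one>\<^bsub>H\<^esub>}" "\<delta> \<in> carrier (Aut H)"
    "out_class H \<delta> \<in> centraliser (Out H) (out_class H \<phi>)"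
  shows "\<exists>!\<alpha>. is_alpha H \<phi> \<delta> \<alpha>"
proof (rule ex_ex1I)
  show "\<exists>\<alpha>. is_alpha H \<phi> \<delta> \<alpha>"
    using assms(2,3) is_alpha_ex by (auto simp: centraliser_iff)
next
  fix \<alpha> \<beta> assume \<alpha>: "is_alpha H \<phi> \<delta> \<alpha>" and \<beta>: "is_alpha H \<phi> \<delta> \<beta>"
  have hom: "group_hom T T \<alpha>" "group_hom T T \<beta>"
    using \<alpha> \<beta> by (auto simp: is_alpha_def Aut_iff group_hom_def group_hom_axioms_def)
  have t: "(\<one>\<^bsub>H\<^esub>, 1) \<in> carrier T" by (simp add: carrier_torus)
  have eq: "\<alpha> (\<one>\<^bsub>H\<^esub>, 1) = \<beta> (\<one>\<^bsub>H\<^esub>, 1)"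
    using \<alpha> \<beta> inner_aut_inj[OF assms(1)] unfolding is_alpha_def by metis
  show "\<alpha> = \<beta>"
  proof (rule Aut_eqI)
    fix x assume "x \<in> carrier T"
    then obtain h m where x: "x = (h, m)" "h \<in> carrier H" by (auto simp: carrier_torus)
    then have h: "(h, 0) \<in> carrier T" by (simp add: carrier_torus)
    have "\<alpha> x = \<alpha> (h, 0) \<otimes>\<^bsub>T\<^esub> \<alpha> (\<one>\<^bsub>H\<^esub>, 1) [^]\<^bsub>T\<^esub> m"
      using x h t hom(1) by (simp add: torus_decomp[of h m] group_hom.hom_mult group_hom.hom_int_pow)
    also have "\<dots> = \<beta> (h, 0) \<otimes>\<^bsub>T\<^esub> \<beta> (\<one>\<^bsub>H\<^esub>, 1) [^]\<^bsub>T\<^esub> m"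
      using \<alpha> \<beta> x by (auto simp: eq elim!: is_alphaD)
    also have "\<dots> = \<beta> x"
      using x h t hom(2) by (simp add: torus_decomp[of h m] group_hom.hom_mult group_hom.hom_int_pow)
    finally show "\<alpha> x = \<beta> x" .
  qed (use \<alpha> \<beta> in \<open>auto simp: is_alpha_def\<close>)
qed

lemma is_alphaI:
  assumes \<alpha>: "\<alpha> \<in> carrier (Aut T)" and \<delta>: "\<delta> \<in> carrier (Aut H)" and g: "g \<in> carrier H"
    and h: "\<And>h. h \<in> carrier H \<Longrightarrow> \<alpha> (h, 0) = (\<delta> h, 0)" and t: "\<alpha> (\<one>\<^bsub>H\<^esub>, 1) = (g, 1)"
  shows "is_alpha H \<phi> \<delta> \<alpha>"
proof -
  have "g \<otimes>\<^bsub>H\<^esub> \<phi> (\<delta> k) = \<delta> (\<phi> k) \<otimes>\<^bsub>H\<^esub> g" if k: "k \<in> carrier H" for k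
  proof -
    have "(\<one>\<^bsub>H\<^esub>, 1) \<otimes>\<^bsub>T\<^esub> (k, 0) = (\<phi> k, 0) \<otimes>\<^bsub>T\<^esub> (\<one>\<^bsub>H\<^esub>, 1)"
      using k \<phi> by (simp add: mult_torus Aut_closed one_Aut)
    then have "\<alpha> ((\<one>\<^bsub>H\<^esub>, 1) \<otimes>\<^bsub>T\<^esub> (k, 0)) = \<alpha> ((\<phi> k, 0) \<otimes>\<^bsub>T\<^esub> (\<one>\<^bsub>H\<^esub>, 1))" by simp
    then have "(g, 1) \<otimes>\<^bsub>T\<^esub> (\<delta> k, 0) = (\<delta> (\<phi> k), 0) \<otimes>\<^bsub>T\<^esub> (g, 1)"
      using \<alpha> k \<phi> t h by (simp add: Aut_mult carrier_torus Aut_closed)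
    then show ?thesis using g k \<phi> \<delta> by (simp add: mult_torus one_Aut)
  qed
  then show ?thesis
    unfolding is_alpha_def using assms \<delta> by (auto simp: commutator_iff mult_torus one_Aut intro!: bexI[of _ g])
qed

lemma Out0_subgroup: "subgroup (Out0 H \<phi>) (Out T)"
proof -
  interpret AT: group "Aut T" by (rule group_Aut[OF group_mapping_torus])
  let ?S = "{\<alpha>. \<exists>\<delta>\<in>carrier (Aut H). is_alpha H \<phi> \<delta> \<alpha>}"
  have "Out0 H \<phi> = out_class T ` ?S"
  proof -
    have "out_class H \<delta> \<in> centraliser (Out H) (out_class H \<phi>)"
      if "\<delta> \<in> carrier (Aut H)" "is_alpha H \<phi> \<delta> \<alpha>" for \<delta> \<alpha>
      using that by (auto simp: centraliser_iff is_alpha_def)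
    then show ?thesis unfolding Out0_def by blast
  qed
  moreover have "subgroup ?S (Aut T)"
  proof (rule AT.subgroupI)
    show "?S \<subseteq> carrier (Aut T)" by (auto simp: is_alpha_def)
    have "is_alpha H \<phi> \<one>\<^bsub>Aut H\<^esub> \<one>\<^bsub>Aut T\<^esub>"
      by (rule is_alphaI[where g = "\<one>\<^bsub>H\<^esub>", OF AT.one_closed A.one_closed])
        (simp_all add: one_Aut carrier_torus)
    then show "?S \<noteq> {}" by blast
  next
    fix \<alpha> assume "\<alpha> \<in> ?S"
    then obtain \<delta> g where \<delta>: "\<delta> \<in> carrier (Aut H)" and \<alpha>: "\<alpha> \<in> carrier (Aut T)" and g: "g \<in> carrier H"
      and h: "\<And>h. h \<in> carrier H \<Longrightarrow> \<alpha> (h, 0) = (\<delta> h, 0)" and t: "\<alpha> (\<one>\<^bsub>H\<^esub>, 1) = (g, 1)"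
      by (auto elim: is_alphaD)
    let ?\<alpha> = "inv\<^bsub>Aut T\<^esub> \<alpha>" and ?\<delta> = "inv\<^bsub>Aut H\<^esub> \<delta>"
    have \<alpha>_inv: "?\<alpha> (\<alpha> x) = x" if "x \<in> carrier T" for x
      using mult_Aut_apply[OF \<alpha> AT.inv_closed[OF \<alpha>] that] \<alpha> that by (simp add: one_Aut)
    have \<delta>_inv: "\<delta> (?\<delta> x) = x" if "x \<in> carrier H" for x
      using mult_Aut_apply[OF A.inv_closed[OF \<delta>] \<delta> that] \<delta> that by (simp add: one_Aut)
    have cl: "?\<delta> x \<in> carrier H" if "x \<in> carrier H" for x
      using Aut_closed[OF A.inv_closed[OF \<delta>] that] .
    have "is_alpha H \<phi> ?\<delta> ?\<alpha>"
    proof (rule is_alphaI[where g = "?\<delta> (inv\<^bsub>H\<^esub> g)"])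
      fix k assume k: "k \<in> carrier H"
      show "?\<alpha> (k, 0) = (?\<delta> k, 0)"
        using \<alpha>_inv[of "(?\<delta> k, 0)"] h[OF cl[OF k]] \<delta>_inv[OF k] cl[OF k] by (simp add: carrier_torus)
    next
      let ?k = "?\<delta> (inv\<^bsub>H\<^esub> g)"
      have k: "?k \<in> carrier H" using g cl by simp
      have "\<alpha> ((?k, 0) \<otimes>\<^bsub>T\<^esub> (\<one>\<^bsub>H\<^esub>, 1)) = (\<one>\<^bsub>H\<^esub>, 1)"
        using g k \<alpha> h t \<delta>_inv by (subst Aut_mult[OF \<alpha>]) (auto simp: carrier_torus mult_torus one_Aut)
      moreover have "(?k, 0) \<otimes>\<^bsub>T\<^esub> (\<one>\<^bsub>H\<^esub>, 1) = (?k, 1)" using k by (simp add: mult_torus one_Aut)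
      ultimately show "?\<alpha> (\<one>\<^bsub>H\<^esub>, 1) = (?k, 1)"
        using \<alpha>_inv[of "(?k, 1)"] k by (simp add: carrier_torus)
    qed (use \<alpha> \<delta> g cl in auto)
    then show "?\<alpha> \<in> ?S" using \<delta> by blast
  next
    fix \<alpha> \<beta> assume "\<alpha> \<in> ?S" "\<beta> \<in> ?S"
    then obtain \<delta> g \<epsilon> k where \<delta>: "\<delta> \<in> carrier (Aut H)" "\<epsilon> \<in> carrier (Aut H)"
      and \<alpha>: "\<alpha> \<in> carrier (Aut T)" "\<beta> \<in> carrier (Aut T)" and g: "g \<in> carrier H" "k \<in> carrier H"
      and h: "\<And>h. h \<in> carrier H \<Longrightarrow> \<alpha> (h, 0) = (\<delta> h, 0)" "\<And>h. h \<in> carrier H \<Longrightarrow> \<beta> (h, 0) = (\<epsilon> h, 0)"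
      and t: "\<alpha> (\<one>\<^bsub>H\<^esub>, 1) = (g, 1)" "\<beta> (\<one>\<^bsub>H\<^esub>, 1) = (k, 1)"
      by (auto elim!: is_alphaD)
    have "is_alpha H \<phi> (\<delta> \<otimes>\<^bsub>Aut H\<^esub> \<epsilon>) (\<alpha> \<otimes>\<^bsub>Aut T\<^esub> \<beta>)"
    proof (rule is_alphaI[where g = "\<epsilon> g \<otimes>\<^bsub>H\<^esub> k"])
      have "(g, 1) = (g, 0) \<otimes>\<^bsub>T\<^esub> (\<one>\<^bsub>H\<^esub>, 1)" using g by (simp add: mult_torus one_Aut)
      then have "\<beta> (g, 1) = \<beta> (g, 0) \<otimes>\<^bsub>T\<^esub> \<beta> (\<one>\<^bsub>H\<^esub>, 1)"
        using \<alpha> g by (simp only:) (simp add: Aut_mult carrier_torus)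
      then show "(\<alpha> \<otimes>\<^bsub>Aut T\<^esub> \<beta>) (\<one>\<^bsub>H\<^esub>, 1) = (\<epsilon> g \<otimes>\<^bsub>H\<^esub> k, 1)"
        using \<alpha> g h t \<delta> by (simp add: mult_Aut_apply carrier_torus mult_torus one_Aut)
    qed (use \<alpha> \<delta> g h in \<open>auto simp: mult_Aut_apply carrier_torus Aut_closed\<close>)
    then show "\<alpha> \<otimes>\<^bsub>Aut T\<^esub> \<beta> \<in> ?S" using \<delta> by blast
  qed
  ultimately show ?thesis
    using group_hom.subgroup_img_is_subgroup[OF out_class_hom[OF group_mapping_torus]] by simp
qed

end

end

theory Submission
  imports Defs
begin

text \<open>
  Write \<open>T\<close> for the mapping torus; it is an extension of \<open>\<int>\<close> by \<open>H\<close>. Let \<open>S\<close> be the group of those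
  automorphisms of \<open>T\<close> that induce the identity on \<open>\<int>\<close>. Its elements are precisely the automorphisms
  \<open>\<alpha>\<^sub>\<delta>\<close> (\<open>is_alpha_iff\<close>), so \<open>Out\<^sup>0\<close> is the image of \<open>S\<close> in \<open>Out(T)\<close>, and sending \<open>\<alpha>\<^sub>\<delta>\<close> to the outer
  class of \<open>\<delta>\<close> is a homomorphism from \<open>S\<close> onto the centraliser of the class of \<open>\<phi>\<close>.

  The isomorphism compares two epimorphisms from \<open>S\<close>, one onto \<open>Out\<^sup>0\<close> and one onto the quotient of
  the centraliser by \<open>\<langle>\<phi>\<rangle>\<close>. The kernel of the first consists of the inner automorphisms of \<open>T\<close>.
  Conjugation by \<open>h t\<^sup>m\<close> restricts on \<open>H\<close> to an automorphism in the class of the power of \<open>\<phi>\<close> with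
  exponent \<open>- m\<close>, so inner automorphisms lie in the second kernel. Since \<open>H\<close> has trivial centre, an
  element of \<open>S\<close> is determined by its restriction to \<open>H\<close>, and the second kernel contains nothing else
  (\<open>out_class_trivial_iff\<close>). Hence both targets are isomorphic (\<open>Out0_iso\<close>).

  For the index, \<open>H\<close> has no nonzero homomorphism to \<open>\<int>\<close>, so every automorphism of \<open>T\<close> preserves \<open>H\<close>
  and induces multiplication by a degree, \<open>1\<close> or \<open>-1\<close>, on \<open>\<int>\<close> (\<open>snd_Aut\<close>, \<open>degree_cases\<close>). The degree is
  multiplicative, and its kernel \<open>S\<close> contains the inner automorphisms, so the index of \<open>Out\<^sup>0\<close> is two if degree \<open>-1\<close> occurs, and
  otherwise \<open>Out\<^sup>0\<close> is everything. An automorphism of degree \<open>-1\<close> restricts to some \<open>\<delta>\<close> on \<open>H\<close> and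
  sends \<open>t\<close> to some \<open>g t\<inverse>\<close>; compatibility with \<open>t h t\<inverse> = \<phi>(h)\<close> says exactly that \<open>\<delta>\<close> conjugates the
  class of \<open>\<phi>\<close> to its inverse up to \<open>\<gamma>\<^sub>g\<close> (\<open>conjugate_inverse_iff\<close>). Conversely such \<open>\<delta>\<close> and \<open>g\<close>
  define an endomorphism by the universal property of \<open>T\<close> (\<open>torus_hom_ex\<close>), which is bijective since
  it is so on \<open>H\<close> and on \<open>\<int>\<close> (\<open>restrict_torus_hom_Aut\<close>).
\<close>

section \<open>Groups, centralisers and maps to the integers\<close>

text \<open>A nonzero homomorphism to \<open>\<int>\<close> has image \<open>d\<int>\<close> with \<open>d > 0\<close>, and dividing it by \<open>d\<close> would give
  an epimorphism onto \<open>\<int>\<close>.\<close>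

lemma hom_integer_group_eq_0:
  assumes "group G" "epi G integer_group = {}" "f \<in> hom G integer_group" "x \<in> carrier G"
  shows "f x = 0"
proof (rule ccontr)
  assume nz: "f x \<noteq> 0"
  interpret group G by fact
  interpret f: group_hom G integer_group f
    using assms by (simp add: group_hom_def group_hom_axioms_def)
  define P where "P n \<longleftrightarrow> 0 < n \<and> (\<exists>a\<in>carrier G. f a = int n)" for n
  define d where "d = (LEAST n. P n)"
  have "P (nat \<bar>f x\<bar>)"
    unfolding P_def using nz assms(4) f.hom_inv[OF assms(4)]
    by (cases "f x > 0") (auto intro: bexI[of _ x] bexI[of _ "inv\<^bsub>G\<^esub> x"])
  then have "P d" unfolding d_def by (rule LeastI)
  then obtain a where d: "0 < d" and a: "a \<in> carrier G" "f a = int d" by (auto simp: P_def)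
  have dvd: "int d dvd f y" if y: "y \<in> carrier G" for y
  proof (rule ccontr)
    assume "\<not> int d dvd f y"
    \<comment> \<open>a remainder modulo the least positive value is again a value\<close>
    let ?y = "y \<otimes>\<^bsub>G\<^esub> a [^]\<^bsub>G\<^esub> (- (f y div int d))"
    have "f ?y = f y mod int d"
      using y a by (simp add: f.hom_int_pow minus_div_mult_eq_mod)
    moreover have "0 < f y mod int d"
      using \<open>\<not> int d dvd f y\<close> d pos_mod_sign[of "int d" "f y"]
      unfolding dvd_eq_mod_eq_0 by linarith
    moreover have "?y \<in> carrier G" using y a by simp
    ultimately have "P (nat (f y mod int d))" unfolding P_def by auto
    then have "d \<le> nat (f y mod int d)" unfolding d_def by (rule Least_le)
    moreover have "nat (f y mod int d) < d" using d by (simp add: nat_less_iff)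
    ultimately show False by simp
  qed
  let ?e = "\<lambda>y. f y div int d"
  have "?e \<in> hom G integer_group"
    by (rule homI) (use dvd in \<open>auto simp: div_plus_div_distrib_dvd_left\<close>)
  moreover have "?e ` carrier G = UNIV"
  proof (intro equalityI subset_UNIV subsetI)
    fix n :: int
    have "?e (a [^]\<^bsub>G\<^esub> n) = n" using a d by (simp add: f.hom_int_pow)
    then show "n \<in> ?e ` carrier G" using a by (metis image_eqI int_pow_closed)
  qed
  ultimately show False using assms(2) by (auto simp: epi_def)
qed

lemma (in group) subgroup_centraliser:
  assumes g: "g \<in> carrier G" shows "subgroup (centraliser G g) G"
proof (rule subgroupI)
  show "centraliser G g \<noteq> {}" using g by (auto simp: centraliser_def)
next
  fix a assume "a \<in> centraliser G g"
  then have a: "a \<in> carrier G" "a \<otimes> g = g \<otimes> a" by (auto simp: centraliser_def)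
  then have "inv a \<otimes> g = g \<otimes> inv a"
    using g by (metis inv_closed inv_solve_left inv_solve_right m_assoc m_closed)
  then show "inv a \<in> centraliser G g" using a by (simp add: centraliser_def)
next
  fix a b assume "a \<in> centraliser G g" "b \<in> centraliser G g"
  then have a: "a \<in> carrier G" "a \<otimes> g = g \<otimes> a" and b: "b \<in> carrier G" "b \<otimes> g = g \<otimes> b"
    by (auto simp: centraliser_def)
  then have "a \<otimes> b \<otimes> g = g \<otimes> (a \<otimes> b)" using g by (metis m_assoc)
  then show "a \<otimes> b \<in> centraliser G g" using a b by (simp add: centraliser_def)
qed (auto simp: centraliser_def)

text \<open>An element is central in its own centraliser, so the cyclic subgroup that it generates is
  normal there.\<close>

lemma (in group) generate_normal_centraliser:
  assumes g: "g \<in> carrier G"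
  shows "generate G {g} \<lhd> G\<lparr>carrier := centraliser G g\<rparr>" (is "?N \<lhd> ?C")
proof -
  have sub: "subgroup (centraliser G g) G" by (rule subgroup_centraliser[OF g])
  interpret C: group ?C by (rule subgroup.subgroup_is_group[OF sub is_group])
  have "g \<in> centraliser G g" using g by (simp add: centraliser_def)
  then have N: "?N \<subseteq> centraliser G g" by (intro generate_subgroup_incl sub) simp
  have sN: "subgroup ?N ?C"
    by (rule subgroup_incl[OF generate_is_subgroup sub N]) (use g in simp)
  have conj: "x \<otimes> h \<otimes> inv x = h" if x: "x \<in> centraliser G g" and h: "h \<in> ?N" for x h
  proof -
    have "x \<in> carrier G" "x \<otimes> g = g \<otimes> x" using x by (auto simp: centraliser_def)
    then have "g \<in> centraliser G x" using g by (simp add: centraliser_def)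
    then have "?N \<subseteq> centraliser G x"
      by (intro generate_subgroup_incl subgroup_centraliser \<open>x \<in> carrier G\<close>) simp
    then have "h \<in> carrier G" "h \<otimes> x = x \<otimes> h" using h by (auto simp: centraliser_def)
    then show ?thesis using \<open>x \<in> carrier G\<close> by (metis inv_solve_right m_closed)
  qed
  show ?thesis
    unfolding C.normal_inv_iff
    using sN conj by (simp add: m_inv_consistent[OF sub])
qed

text \<open>The last hypothesis says that all elements outside \<open>K\<close> lie in the coset of \<open>c\<close>.\<close>

lemma (in group) card_rcosets_eq_2:
  assumes K: "subgroup K G" and c: "c \<in> carrier G" "c \<notin> K"
    and two: "\<And>x. x \<in> carrier G \<Longrightarrow> x \<notin> K \<Longrightarrow> x \<otimes> inv c \<in> K"
  shows "card (rcosets K) = 2"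
proof -
  interpret K: subgroup K G by (rule K)
  have "K #> x = K #> c" if x: "x \<in> carrier G" "x \<notin> K" for x
  proof -
    have "x \<otimes> inv c \<otimes> c \<in> K #> c" using two[OF x] c by (intro rcosI) auto
    then have "x \<in> K #> c" using x c by (simp add: m_assoc)
    then show ?thesis using repr_independence[OF _ c(1) K, of x] by simp
  qed
  moreover have "K #> x = K" if "x \<in> K" for x using K.rcos_const[OF is_group that] .
  ultimately have "rcosets K \<subseteq> {K, K #> c}" unfolding RCOSETS_def by blast
  moreover have "K \<in> rcosets K" using K.rcos_const[OF is_group K.one_closed]
    by (auto simp: RCOSETS_def intro!: bexI[of _ \<one>])
  moreover have "K #> c \<in> rcosets K" using c by (auto simp: RCOSETS_def)
  ultimately have "rcosets K = {K, K #> c}" by blast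
  moreover have "K \<noteq> K #> c" using c rcos_self[OF c(1) K] by blast
  ultimately show ?thesis by simp
qed

text \<open>Two epimorphisms from one group with the same kernel identify their targets. This compares two
  groups without choosing representatives in either of them.\<close>

lemma iso_of_homs_with_equal_kernels:
  assumes f: "group_hom G A f" "f ` carrier G = carrier A"
    and g: "group_hom G B g" "g ` carrier G = carrier B"
    and ker: "kernel G A f = kernel G B g"
  shows "A \<cong> B"
proof -
  interpret f: group_hom G A f by fact
  interpret g: group_hom G B g by fact
  have "G Mod kernel G A f \<cong> A" by (rule f.FactGroup_iso[OF f(2)])
  moreover have "G Mod kernel G A f \<cong> B" unfolding ker by (rule g.FactGroup_iso[OF g(2)])
  moreover have "group (G Mod kernel G A f)"
    by (rule normal.factorgroup_is_group[OF f.normal_kernel])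
  ultimately show ?thesis by (meson group.iso_sym iso_trans)
qed

lemma out_class_surj: "out_class G ` carrier (Aut G) = carrier (Out G)"
  by (auto simp: Out_def out_class_def FactGroup_def RCOSETS_def)

section \<open>Homomorphisms out of a mapping torus\<close>

locale group_with_automorphism = group H for H :: "('a, 'b) monoid_scheme" (structure) +
  fixes \<phi> :: "'a \<Rightarrow> 'a"
  assumes phi [simp]: "\<phi> \<in> carrier (Aut H)"
begin

abbreviation torus where "torus \<equiv> mapping_torus H \<phi>"
abbreviation t where "t \<equiv> (\<one>, 1::int)"

sublocale A: group "Aut H" by (rule group_Aut[OF is_group])
sublocale T: group torus by (rule group_mapping_torus[OF is_group phi])
sublocale AT: group "Aut torus" by (rule group_Aut[OF T.is_group])
sublocale O: group "Out H" by (rule group_Out[OF is_group])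
sublocale OT: group "Out torus" by (rule group_Out[OF T.is_group])
sublocale cls: group_hom "Aut H" "Out H" "out_class H" by (rule out_class_hom[OF is_group])
sublocale clsT: group_hom "Aut torus" "Out torus" "out_class torus"
  by (rule out_class_hom[OF T.is_group])

lemmas torus_simps = carrier_torus[OF is_group phi] mult_torus[OF is_group phi]
  one_torus[OF is_group phi]

lemma phi_pow_closed [simp]: "h \<in> carrier H \<Longrightarrow> (\<phi> [^]\<^bsub>Aut H\<^esub> (m::int)) h \<in> carrier H"
  by (rule Aut_closed[OF pow_Aut[OF is_group phi]])

lemma t_in_torus [simp]: "t \<in> carrier torus"
  by (simp add: torus_simps)

lemma fibre_in_torus [simp]: "h \<in> carrier H \<Longrightarrow> (h, m) \<in> carrier torus"
  by (simp add: torus_simps)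

lemma snd_mult_torus: "snd (x \<otimes>\<^bsub>torus\<^esub> y) = snd x + snd y"
  by (cases x; cases y) (simp add: torus_simps)

lemma snd_hom: "group_hom torus integer_group snd"
  by (auto simp: group_hom_def group_hom_axioms_def hom_def snd_mult_torus T.is_group)

lemma Aut_group_hom: "\<alpha> \<in> carrier (Aut torus) \<Longrightarrow> group_hom torus torus \<alpha>"
  by (auto simp: Aut_iff group_hom_def group_hom_axioms_def T.is_group)

text \<open>The existence part of the universal property of the presentation \<open>\<langle>H, t; t h t\<inverse> = \<phi>(h)\<rangle>\<close>: a
  homomorphism on \<open>H\<close> and a value for \<open>t\<close> that satisfy the defining relation extend to the whole
  torus. On normal forms the extension sends \<open>h t\<^sup>m\<close> to \<open>f(h) s\<^sup>m\<close>; it is multiplicative because the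
  relation passes to all powers of \<open>s\<close>, negative ones included.\<close>

lemma torus_hom_ex:
  assumes K: "group K" and f: "f \<in> hom H K" and s: "s \<in> carrier K"
    and rel: "\<And>h. h \<in> carrier H \<Longrightarrow> s \<otimes>\<^bsub>K\<^esub> f h = f (\<phi> h) \<otimes>\<^bsub>K\<^esub> s"
  shows "\<exists>\<alpha>\<in>hom torus K. (\<forall>h\<in>carrier H. \<alpha> (h, 0) = f h) \<and> \<alpha> t = s"
proof -
  interpret K: group K by fact
  interpret f: group_hom H K f using K f by (simp add: group_hom_def group_hom_axioms_def is_group)
  let ?p = "\<lambda>m::int. \<phi> [^]\<^bsub>Aut H\<^esub> m"
  let ?s = "\<lambda>m::int. s [^]\<^bsub>K\<^esub> m"
  have p1: "?p 1 h = \<phi> h" for h by (simp add: A.int_pow_1)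
  have rel_pow: "\<forall>h\<in>carrier H. ?s m \<otimes>\<^bsub>K\<^esub> f h = f (?p m h) \<otimes>\<^bsub>K\<^esub> ?s m" for m
  proof (induction m rule: int_induct[where k = 0])
    case base
    show ?case by (simp add: one_Aut)
  next
    case (step1 m)
    show ?case
    proof
      fix h assume h: "h \<in> carrier H"
      have h': "\<phi> h \<in> carrier H" using h by (simp add: Aut_closed)
      have "?s (m + 1) \<otimes>\<^bsub>K\<^esub> f h = ?s m \<otimes>\<^bsub>K\<^esub> (s \<otimes>\<^bsub>K\<^esub> f h)"
        using h s by (simp add: K.int_pow_mult K.m_assoc)
      also have "\<dots> = ?s m \<otimes>\<^bsub>K\<^esub> f (\<phi> h) \<otimes>\<^bsub>K\<^esub> s"
        using h h' s by (simp add: rel K.m_assoc)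
      also have "\<dots> = f (?p (m + 1) h) \<otimes>\<^bsub>K\<^esub> ?s (m + 1)"
        using h h' s step1.IH
        by (simp add: pow_Aut_add[OF is_group phi] p1 K.int_pow_mult K.m_assoc)
      finally show "?s (m + 1) \<otimes>\<^bsub>K\<^esub> f h = f (?p (m + 1) h) \<otimes>\<^bsub>K\<^esub> ?s (m + 1)" .
    qed
  next
    case (step2 m)
    show ?case
    proof
      fix h assume h: "h \<in> carrier H"
      \<comment> \<open>to step down, apply the relation to the preimage of \<open>h\<close> under \<open>\<phi>\<close> and cancel \<open>s\<close> on the right\<close>
      define k where "k = ?p (- 1) h"
      have k: "k \<in> carrier H" "\<phi> k \<in> carrier H" using h by (simp_all add: k_def Aut_closed)
      have "?p 1 (?p (- 1) h) = ?p 0 h" using pow_Aut_add[OF is_group phi h, of 1 "- 1"] by simp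
      then have hk: "\<phi> k = h" using pow_Aut_0[OF is_group phi h] by (simp add: p1 k_def)
      have "?s (m - 1) \<otimes>\<^bsub>K\<^esub> f h \<otimes>\<^bsub>K\<^esub> s = ?s (m - 1) \<otimes>\<^bsub>K\<^esub> (s \<otimes>\<^bsub>K\<^esub> f k)"
        using h k s by (simp add: rel hk K.m_assoc)
      also have "\<dots> = ?s m \<otimes>\<^bsub>K\<^esub> f k"
        using h k s K.int_pow_mult[OF s, of "m - 1" 1] by (simp add: K.m_assoc)
      also have "\<dots> = f (?p (m - 1) h) \<otimes>\<^bsub>K\<^esub> ?s m"
        using step2.IH k pow_Aut_add[OF is_group phi h, of m "- 1"] by (simp add: k_def)
      also have "\<dots> = f (?p (m - 1) h) \<otimes>\<^bsub>K\<^esub> ?s (m - 1) \<otimes>\<^bsub>K\<^esub> s"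
        using h s K.int_pow_mult[OF s, of "m - 1" 1] by (simp add: K.m_assoc)
      finally show "?s (m - 1) \<otimes>\<^bsub>K\<^esub> f h = f (?p (m - 1) h) \<otimes>\<^bsub>K\<^esub> ?s (m - 1)"
        using h s by simp
    qed
  qed
  define \<alpha> where "\<alpha> = (\<lambda>(h, m). f h \<otimes>\<^bsub>K\<^esub> ?s m)"
  have "\<alpha> \<in> hom torus K"
  proof (rule homI)
    fix x assume "x \<in> carrier torus"
    then show "\<alpha> x \<in> carrier K" using s by (auto simp: \<alpha>_def torus_simps)
  next
    fix x y assume "x \<in> carrier torus" "y \<in> carrier torus"
    then obtain h m k n where x: "x = (h, m)" "h \<in> carrier H" and y: "y = (k, n)" "k \<in> carrier H"
      by (auto simp: torus_simps)
    have "\<alpha> (x \<otimes>\<^bsub>torus\<^esub> y) = f h \<otimes>\<^bsub>K\<^esub> (f (?p m k) \<otimes>\<^bsub>K\<^esub> ?s m) \<otimes>\<^bsub>K\<^esub> ?s n"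
      using x y s by (simp add: \<alpha>_def torus_simps K.int_pow_mult K.m_assoc)
    also have "\<dots> = f h \<otimes>\<^bsub>K\<^esub> (?s m \<otimes>\<^bsub>K\<^esub> f k) \<otimes>\<^bsub>K\<^esub> ?s n"
      using rel_pow y by simp
    also have "\<dots> = \<alpha> x \<otimes>\<^bsub>K\<^esub> \<alpha> y"
      using x y s by (simp add: \<alpha>_def K.m_assoc)
    finally show "\<alpha> (x \<otimes>\<^bsub>torus\<^esub> y) = \<alpha> x \<otimes>\<^bsub>K\<^esub> \<alpha> y" .
  qed
  then show ?thesis
    by (rule bexI[rotated]) (use s in \<open>auto simp: \<alpha>_def K.int_pow_1\<close>)
qed

text \<open>A five-lemma argument for the extension \<open>1 \<rightarrow> H \<rightarrow> H\<^sub>\<phi> \<rightarrow> \<int> \<rightarrow> 0\<close>: an endomorphism that is bijective on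
  \<open>H\<close> and on \<open>\<int>\<close> is bijective. The restriction to the carrier is there because elements of
  \<open>Aut\<close> are extensional.\<close>

lemma restrict_torus_hom_Aut:
  assumes hom: "\<alpha> \<in> hom torus torus" and \<delta>: "\<delta> \<in> carrier (Aut H)"
    and fib: "\<And>h. h \<in> carrier H \<Longrightarrow> \<alpha> (h, 0) = (\<delta> h, 0)"
    and e: "snd (\<alpha> t) = e" "e = 1 \<or> e = - 1"
  shows "restrict \<alpha> (carrier torus) \<in> carrier (Aut torus)"
proof -
  interpret \<alpha>: group_hom torus torus \<alpha>
    using hom by (simp add: group_hom_def group_hom_axioms_def T.is_group)
  interpret snd: group_hom torus integer_group snd by (rule snd_hom)
  define s where "s = \<alpha> t"
  have s: "s \<in> carrier torus" "snd s = e" using e(1) by (simp_all add: s_def)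
  have \<alpha>_eq: "\<alpha> (h, m) = (\<delta> h, 0) \<otimes>\<^bsub>torus\<^esub> s [^]\<^bsub>torus\<^esub> m" if "h \<in> carrier H" for h m
    using that by (simp add: torus_decomp[OF is_group phi, of h m] \<alpha>.hom_int_pow fib s_def)
  have snd_\<alpha>: "snd (\<alpha> x) = e * snd x" if "x \<in> carrier torus" for x
    using that s by (cases x) (auto simp: \<alpha>_eq snd_mult_torus snd.hom_int_pow carrier_torus[OF is_group phi])
  have inj: "inj_on \<alpha> (carrier torus)"
  proof (rule \<alpha>.inj_on_one_iff[THEN iffD2], intro allI impI)
    fix x assume x: "x \<in> carrier torus" and one: "\<alpha> x = \<one>\<^bsub>torus\<^esub>"
    have "snd x = 0" using snd_\<alpha>[OF x] one e(2) by (auto simp: torus_simps)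
    then obtain h where h: "x = (h, 0)" "h \<in> carrier H" using x by (cases x) (auto simp: torus_simps)
    then have "\<delta> h = \<delta> \<one>" using one fib[of h] Aut_one[OF is_group \<delta>] by (simp add: torus_simps)
    then have "h = \<one>" using \<delta> h by (auto simp: Aut_iff bij_betw_def dest: inj_onD)
    then show "x = \<one>\<^bsub>torus\<^esub>" using h by (simp add: torus_simps)
  qed
  have surj: "y \<in> \<alpha> ` carrier torus" if y: "y \<in> carrier torus" for y
  proof -
    \<comment> \<open>\<open>e\<close> is its own inverse, so a power of \<open>\<alpha>(t)\<close> moves \<open>y\<close> into the fibre \<open>H\<close>\<close>
    define u where "u = y \<otimes>\<^bsub>torus\<^esub> inv\<^bsub>torus\<^esub> (s [^]\<^bsub>torus\<^esub> (e * snd y))"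
    have u: "u \<in> carrier torus" using y s by (simp add: u_def)
    have "snd u = 0" using y e(2) s snd.hom_inv by (auto simp: u_def snd_mult_torus snd.hom_int_pow)
    then obtain k where k: "u = (k, 0)" "k \<in> carrier H" using u by (cases u) (auto simp: torus_simps)
    then obtain h where h: "h \<in> carrier H" "\<delta> h = k" using \<delta> by (metis Aut_iff bij_betw_def imageE)
    have "\<alpha> (h, e * snd y) = u \<otimes>\<^bsub>torus\<^esub> s [^]\<^bsub>torus\<^esub> (e * snd y)"
      using h k by (simp add: \<alpha>_eq)
    also have "\<dots> = y" using y s by (simp add: u_def T.m_assoc)
    finally show ?thesis using h by (metis fibre_in_torus image_eqI)
  qed
  have "bij_betw \<alpha> (carrier torus) (carrier torus)"
    using inj surj by (auto simp: bij_betw_def)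
  moreover have "restrict \<alpha> (carrier torus) \<in> hom torus torus"
    by (rule homI) simp_all
  ultimately show ?thesis by (simp add: Aut_iff cong: bij_betw_cong)
qed

section \<open>Automorphisms inducing the identity on the integers\<close>

definition restr :: "('a \<times> int \<Rightarrow> 'a \<times> int) \<Rightarrow> 'a \<Rightarrow> 'a" where
  "restr \<alpha> = (\<lambda>h\<in>carrier H. fst (\<alpha> (h, 0)))"

definition Aut_over_int :: "('a \<times> int \<Rightarrow> 'a \<times> int) set" where
  "Aut_over_int = {\<alpha> \<in> carrier (Aut torus). \<forall>x\<in>carrier torus. snd (\<alpha> x) = snd x}"

text \<open>An automorphism whose induced map on \<open>\<int>\<close> has trivial kernel maps \<open>H\<close> onto \<open>H\<close>: the preimage of
  an element of \<open>H\<close> lies in \<open>H\<close> again. Both degrees \<open>1\<close> and \<open>-1\<close> are covered.\<close>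

lemma restr_in_Aut:
  assumes \<alpha>: "\<alpha> \<in> carrier (Aut torus)"
    and fib: "\<And>x. x \<in> carrier torus \<Longrightarrow> snd (\<alpha> x) = 0 \<longleftrightarrow> snd x = 0"
  shows "restr \<alpha> \<in> carrier (Aut H)"
    and "\<And>h. h \<in> carrier H \<Longrightarrow> \<alpha> (h, 0) = (restr \<alpha> h, 0)"
proof -
  show eq: "\<alpha> (h, 0) = (restr \<alpha> h, 0)" if "h \<in> carrier H" for h
    using that fib[of "(h, 0)"] by (simp add: restr_def prod_eq_iff)
  have cl: "restr \<alpha> h \<in> carrier H" if "h \<in> carrier H" for h
    using Aut_closed[OF \<alpha>, of "(h, 0)"] that by (simp add: eq torus_simps)
  have "restr \<alpha> \<in> hom H H"
  proof (rule homI)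
    fix h k assume hk: "h \<in> carrier H" "k \<in> carrier H"
    have "\<alpha> (h \<otimes> k, 0) = \<alpha> ((h, 0) \<otimes>\<^bsub>torus\<^esub> (k, 0))"
      using hk by (simp add: torus_simps one_Aut)
    also have "\<dots> = (restr \<alpha> h, 0) \<otimes>\<^bsub>torus\<^esub> (restr \<alpha> k, 0)"
      using hk \<alpha> by (simp add: Aut_mult eq)
    finally show "restr \<alpha> (h \<otimes> k) = restr \<alpha> h \<otimes> restr \<alpha> k"
      using hk cl by (simp add: eq torus_simps one_Aut)
  qed (rule cl)
  moreover have "inj_on (restr \<alpha>) (carrier H)"
  proof (rule inj_onI)
    fix h k assume hk: "h \<in> carrier H" "k \<in> carrier H" "restr \<alpha> h = restr \<alpha> k"
    then have "\<alpha> (h, 0) = \<alpha> (k, 0)" by (simp add: eq)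
    moreover have "inj_on \<alpha> (carrier torus)" using \<alpha> by (simp add: Aut_iff bij_betw_def)
    ultimately show "h = k" using hk by (auto dest: inj_onD)
  qed
  moreover have "k \<in> restr \<alpha> ` carrier H" if k: "k \<in> carrier H" for k
  proof -
    have "(k, 0) \<in> \<alpha> ` carrier torus" using \<alpha> k by (simp add: Aut_iff bij_betw_def)
    then obtain x where x: "x \<in> carrier torus" "\<alpha> x = (k, 0)" by auto
    then obtain h where "x = (h, 0)" "h \<in> carrier H"
      using fib[of x] by (cases x) (auto simp: torus_simps)
    then show ?thesis using x by (auto simp: eq)
  qed
  ultimately show "restr \<alpha> \<in> carrier (Aut H)"
    using cl by (auto simp: Aut_iff bij_betw_def) (simp add: restr_def)
qed

lemma Aut_over_intD:
  assumes "\<alpha> \<in> Aut_over_int"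
  shows "\<alpha> \<in> carrier (Aut torus)" and "x \<in> carrier torus \<Longrightarrow> snd (\<alpha> x) = snd x"
    and "restr \<alpha> \<in> carrier (Aut H)"
    and "h \<in> carrier H \<Longrightarrow> \<alpha> (h, 0) = (restr \<alpha> h, 0)"
  using assms restr_in_Aut[of \<alpha>] by (auto simp: Aut_over_int_def)

lemma subgroup_Aut_over_int: "subgroup Aut_over_int (Aut torus)"
proof (rule AT.subgroupI)
  have "\<one>\<^bsub>Aut torus\<^esub> \<in> Aut_over_int"
    using AT.one_closed by (simp add: Aut_over_int_def one_Aut)
  then show "Aut_over_int \<noteq> {}" by blast
next
  fix \<alpha> assume \<alpha>: "\<alpha> \<in> Aut_over_int"
  note \<alpha>' = Aut_over_intD(1,2)[OF \<alpha>]
  have "snd ((inv\<^bsub>Aut torus\<^esub> \<alpha>) x) = snd x" if x: "x \<in> carrier torus" for x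
  proof -
    let ?y = "(inv\<^bsub>Aut torus\<^esub> \<alpha>) x"
    have y: "?y \<in> carrier torus" using \<alpha>'(1) x by (simp add: Aut_closed)
    have "\<alpha> ?y = x"
      using mult_Aut_apply[OF AT.inv_closed[OF \<alpha>'(1)] \<alpha>'(1) x] \<alpha>'(1) x by (simp add: one_Aut)
    then show ?thesis using \<alpha>'(2)[OF y] by simp
  qed
  then show "inv\<^bsub>Aut torus\<^esub> \<alpha> \<in> Aut_over_int" using \<alpha>'(1) by (simp add: Aut_over_int_def)
next
  fix \<alpha> \<beta> assume "\<alpha> \<in> Aut_over_int" "\<beta> \<in> Aut_over_int"
  then show "\<alpha> \<otimes>\<^bsub>Aut torus\<^esub> \<beta> \<in> Aut_over_int"
    by (simp add: Aut_over_int_def mult_Aut_apply Aut_closed)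
qed (auto simp: Aut_over_int_def)

lemma restr_mult:
  assumes \<alpha>: "\<alpha> \<in> Aut_over_int" and \<beta>: "\<beta> \<in> Aut_over_int"
  shows "restr (\<alpha> \<otimes>\<^bsub>Aut torus\<^esub> \<beta>) = restr \<alpha> \<otimes>\<^bsub>Aut H\<^esub> restr \<beta>"
proof (rule Aut_eqI[where G = H])
  have m: "\<alpha> \<otimes>\<^bsub>Aut torus\<^esub> \<beta> \<in> Aut_over_int"
    by (rule subgroup.m_closed[OF subgroup_Aut_over_int \<alpha> \<beta>])
  show "restr (\<alpha> \<otimes>\<^bsub>Aut torus\<^esub> \<beta>) \<in> carrier (Aut H)" by (rule Aut_over_intD(3)[OF m])
  show "restr \<alpha> \<otimes>\<^bsub>Aut H\<^esub> restr \<beta> \<in> carrier (Aut H)"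
    using Aut_over_intD(3) \<alpha> \<beta> by simp
  fix h assume h: "h \<in> carrier H"
  then show "restr (\<alpha> \<otimes>\<^bsub>Aut torus\<^esub> \<beta>) h = (restr \<alpha> \<otimes>\<^bsub>Aut H\<^esub> restr \<beta>) h"
    using Aut_over_intD(4)[OF m h] Aut_over_intD[OF \<alpha>] Aut_over_intD[OF \<beta>]
    by (simp add: mult_Aut_apply Aut_closed)
qed

text \<open>The automorphisms \<open>\<alpha>\<^sub>\<delta>\<close> are exactly those that induce the identity on \<open>\<int>\<close>. One direction holds
  because \<open>h t\<^sup>m\<close> goes to \<open>\<delta>(h) (g t)\<^sup>m\<close>; in the other, \<open>\<alpha>(t)\<close> lies over \<open>1\<close>, hence has the form
  \<open>g t\<close>, and applying \<open>\<alpha>\<close> to the relation \<open>t h t\<inverse> = \<phi>(h)\<close> shows \<open>[\<delta>, \<phi>] = \<gamma>\<^sub>g\<close>.\<close>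

lemma is_alpha_iff:
  assumes \<delta>: "\<delta> \<in> carrier (Aut H)"
  shows "is_alpha H \<phi> \<delta> \<alpha> \<longleftrightarrow> \<alpha> \<in> Aut_over_int \<and> restr \<alpha> = \<delta>"
proof
  assume "is_alpha H \<phi> \<delta> \<alpha>"
  then obtain g where \<alpha>: "\<alpha> \<in> carrier (Aut torus)" and g: "g \<in> carrier H"
    and h: "\<And>h. h \<in> carrier H \<Longrightarrow> \<alpha> (h, 0) = (\<delta> h, 0)" and s: "\<alpha> t = (g, 1)"
    by (rule is_alphaD[OF is_group phi]) blast
  interpret \<alpha>: group_hom torus torus \<alpha> by (rule Aut_group_hom[OF \<alpha>])
  interpret snd: group_hom torus integer_group snd by (rule snd_hom)
  have "snd (\<alpha> x) = snd x" if x: "x \<in> carrier torus" for x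
  proof -
    obtain k m where k: "x = (k, m)" "k \<in> carrier H" using x by (cases x) (auto simp: torus_simps)
    then have "\<alpha> x = (\<delta> k, 0) \<otimes>\<^bsub>torus\<^esub> (g, 1) [^]\<^bsub>torus\<^esub> m"
      by (simp add: torus_decomp[OF is_group phi, of k m] \<alpha>.hom_int_pow h s)
    then show ?thesis using k g by (simp add: snd_mult_torus snd.hom_int_pow)
  qed
  then have m: "\<alpha> \<in> Aut_over_int" using \<alpha> by (simp add: Aut_over_int_def)
  have "restr \<alpha> = \<delta>"
    by (rule Aut_eqI[OF Aut_over_intD(3)[OF m] \<delta>]) (simp add: restr_def h)
  with m show "\<alpha> \<in> Aut_over_int \<and> restr \<alpha> = \<delta>" by simp
next
  assume *: "\<alpha> \<in> Aut_over_int \<and> restr \<alpha> = \<delta>"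
  then have \<alpha>: "\<alpha> \<in> Aut_over_int" by simp
  have "\<alpha> t \<in> carrier torus" using Aut_closed[OF Aut_over_intD(1)[OF \<alpha>] t_in_torus] .
  moreover have "snd (\<alpha> t) = 1" using Aut_over_intD(2)[OF \<alpha> t_in_torus] by simp
  ultimately obtain g where "g \<in> carrier H" "\<alpha> t = (g, 1)"
    by (cases "\<alpha> t") (auto simp: torus_simps)
  then show "is_alpha H \<phi> \<delta> \<alpha>"
    using is_alphaI[OF is_group phi Aut_over_intD(1)[OF \<alpha>] \<delta>] Aut_over_intD(4)[OF \<alpha>] * by simp
qed

section \<open>Passage to outer classes\<close>

lemma restr_centralises:
  assumes "\<alpha> \<in> Aut_over_int"
  shows "out_class H (restr \<alpha>) \<in> centraliser (Out H) (out_class H \<phi>)"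
  using is_alpha_iff[OF Aut_over_intD(3)[OF assms]] assms Aut_over_intD(3)[OF assms]
  by (auto simp: is_alpha_def centraliser_iff[OF is_group phi])

lemma restr_onto_centraliser:
  "(\<lambda>\<alpha>. out_class H (restr \<alpha>)) ` Aut_over_int = centraliser (Out H) (out_class H \<phi>)"
proof (intro equalityI subsetI)
  fix c assume c: "c \<in> centraliser (Out H) (out_class H \<phi>)"
  then obtain \<delta> where \<delta>: "\<delta> \<in> carrier (Aut H)" "c = out_class H \<delta>"
    using out_class_surj[of H] unfolding centraliser_def by blast
  then obtain \<alpha> where "is_alpha H \<phi> \<delta> \<alpha>"
    using c is_alpha_ex[OF is_group phi] by (auto simp: centraliser_iff[OF is_group phi])
  then show "c \<in> (\<lambda>\<alpha>. out_class H (restr \<alpha>)) ` Aut_over_int"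
    using \<delta> by (auto simp: is_alpha_iff)
qed (auto simp: restr_centralises)

lemma Out0_eq: "Out0 H \<phi> = out_class torus ` Aut_over_int"
proof (intro equalityI subsetI)
  fix c assume "c \<in> Out0 H \<phi>"
  then show "c \<in> out_class torus ` Aut_over_int" by (auto simp: Out0_def is_alpha_iff)
next
  fix c assume "c \<in> out_class torus ` Aut_over_int"
  then obtain \<alpha> where \<alpha>: "\<alpha> \<in> Aut_over_int" "c = out_class torus \<alpha>" by auto
  then show "c \<in> Out0 H \<phi>"
    using is_alpha_iff[OF Aut_over_intD(3)[OF \<alpha>(1)], of \<alpha>] Aut_over_intD(3)[OF \<alpha>(1)]
      restr_centralises[OF \<alpha>(1)]
    unfolding Out0_def by blast
qed

text \<open>With trivial centre, the element \<open>g\<close> with \<open>\<alpha>(t) = g t\<close> is determined by the inner automorphism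
  \<open>\<gamma>\<^sub>g = [\<delta>, \<phi>]\<close>, and hence by \<open>\<delta>\<close>.\<close>

lemma restr_inj:
  assumes "centre H = {\<one>}" "\<alpha> \<in> Aut_over_int" "\<beta> \<in> Aut_over_int" "restr \<alpha> = restr \<beta>"
  shows "\<alpha> = \<beta>"
  using is_alpha_ex1[OF is_group phi assms(1) Aut_over_intD(3)[OF assms(2)]
      restr_centralises[OF assms(2)]] assms(2-4)
    is_alpha_iff[OF Aut_over_intD(3)[OF assms(2)]] by metis

text \<open>The integers are abelian, so conjugation does not change the exponent of \<open>t\<close>.\<close>

lemma inner_aut_over_int:
  assumes x: "x \<in> carrier torus" shows "inner_aut torus x \<in> Aut_over_int"
proof -
  interpret snd: group_hom torus integer_group snd by (rule snd_hom)
  show ?thesis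
    using inner_aut_in_Aut[OF T.is_group x] x snd.hom_inv[OF x]
    by (simp add: Aut_over_int_def) (simp add: inner_aut_def snd_mult_torus)
qed

lemma restr_inner_aut_fibre:
  assumes h: "h \<in> carrier H"
  shows "restr (inner_aut torus (h, 0)) = inner_aut H h"
proof (rule Aut_eqI[where G = H])
  have m: "inner_aut torus (h, 0) \<in> Aut_over_int" using h by (intro inner_aut_over_int) simp
  show "restr (inner_aut torus (h, 0)) \<in> carrier (Aut H)" by (rule Aut_over_intD(3)[OF m])
  show "inner_aut H h \<in> carrier (Aut H)" by (rule inner_aut_in_Aut[OF is_group h])
  fix k assume k: "k \<in> carrier H"
  have "inv\<^bsub>torus\<^esub> (h, 0) = (inv h, 0)"
    by (rule T.inv_equality) (use h in \<open>auto simp: torus_simps one_Aut\<close>)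
  then show "restr (inner_aut torus (h, 0)) k = inner_aut H h k"
    using h k by (simp add: restr_def inner_aut_def) (simp add: torus_simps one_Aut)
qed

lemma restr_inner_aut_inv_t: "restr (inner_aut torus (inv\<^bsub>torus\<^esub> t)) = \<phi>"
proof (rule Aut_eqI[where G = H])
  have m: "inner_aut torus (inv\<^bsub>torus\<^esub> t) \<in> Aut_over_int" by (intro inner_aut_over_int) simp
  show "restr (inner_aut torus (inv\<^bsub>torus\<^esub> t)) \<in> carrier (Aut H)" by (rule Aut_over_intD(3)[OF m])
  fix k assume k: "k \<in> carrier H"
  show "restr (inner_aut torus (inv\<^bsub>torus\<^esub> t)) k = \<phi> k"
    using torus_relation[OF is_group phi k] k by (simp add: restr_def inner_aut_def)
qed (rule phi)

abbreviation AutZ where "AutZ \<equiv> (Aut torus)\<lparr>carrier := Aut_over_int\<rparr>"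

lemma group_AutZ: "group AutZ"
  by (rule subgroup.subgroup_is_group[OF subgroup_Aut_over_int AT.is_group])

lemma restr_hom: "group_hom AutZ (Out H) (\<lambda>\<alpha>. out_class H (restr \<alpha>))"
  by (auto simp: group_hom_def group_hom_axioms_def group_AutZ O.is_group hom_def restr_mult
      Aut_over_intD(3))

text \<open>Conjugation by \<open>h\<close> restricts to an inner automorphism of \<open>H\<close>, and conjugation by \<open>t\<close>, taken as
  \<open>x \<mapsto> t\<inverse> x t\<close>, restricts to \<open>\<phi>\<inverse>\<close>; hence the sign of the exponent.\<close>

lemma restr_inner_class:
  assumes h: "h \<in> carrier H"
  shows "out_class H (restr (inner_aut torus (h, m))) = out_class H \<phi> [^]\<^bsub>Out H\<^esub> (- m)"
proof -
  let ?r = "\<lambda>x. out_class H (restr (inner_aut torus x))"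
  interpret r: group_hom AutZ "Out H" "\<lambda>\<alpha>. out_class H (restr \<alpha>)" by (rule restr_hom)
  interpret \<rho>: group_hom torus "Out H" ?r
  proof -
    have "inner_aut torus \<in> hom torus AutZ"
      by (rule homI) (auto simp: inner_aut_over_int inner_aut_mult[OF T.is_group])
    then have "?r \<in> hom torus (Out H)"
      using Group.hom_compose[OF _ r.homh] by (fastforce simp: comp_def)
    then show "group_hom torus (Out H) ?r"
      by (simp add: group_hom_def group_hom_axioms_def O.is_group T.is_group)
  qed
  have "?r (inv\<^bsub>torus\<^esub> t) = out_class H \<phi>" by (simp add: restr_inner_aut_inv_t)
  then have "?r t = inv\<^bsub>Out H\<^esub> (out_class H \<phi>)"
    using \<rho>.hom_inv[OF t_in_torus] \<rho>.hom_closed[OF t_in_torus] by (metis O.inv_inv)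
  moreover have "?r (h, 0) = \<one>\<^bsub>Out H\<^esub>"
    by (simp add: restr_inner_aut_fibre[OF h] out_class_eq_one[OF is_group phi h])
  moreover have "?r (h, m) = ?r (h, 0) \<otimes>\<^bsub>Out H\<^esub> ?r t [^]\<^bsub>Out H\<^esub> m"
    using h by (simp only: torus_decomp[OF is_group phi h, of m] \<rho>.hom_mult \<rho>.hom_int_pow
        fibre_in_torus t_in_torus T.int_pow_closed)
  ultimately show ?thesis by (simp add: O.int_pow_inv O.int_pow_neg)
qed

text \<open>This is where the cyclic group \<open>\<langle>\<phi>\<rangle>\<close> enters. Inner automorphisms of the torus restrict to
  automorphisms of \<open>H\<close> in the outer classes of the powers of \<open>\<phi>\<close>. Conversely, if the restriction of
  \<open>\<alpha>\<close> has the class of a power of \<open>\<phi>\<close>, then it agrees with the restriction of an inner automorphism,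
  and a restriction determines the automorphism when the centre is trivial.\<close>

lemma out_class_trivial_iff:
  assumes centre: "centre H = {\<one>}" and \<alpha>: "\<alpha> \<in> Aut_over_int"
  shows "out_class torus \<alpha> = \<one>\<^bsub>Out torus\<^esub> \<longleftrightarrow>
    out_class H (restr \<alpha>) \<in> generate (Out H) {out_class H \<phi>}"
proof -
  have gen: "generate (Out H) {out_class H \<phi>} = {out_class H \<phi> [^]\<^bsub>Out H\<^esub> (m::int) |m. m \<in> UNIV}"
    by (rule O.generate_pow) simp
  interpret N: normal "Inn torus" "Aut torus" by (rule Inn_normal[OF T.is_group])
  have "out_class torus \<alpha> = \<one>\<^bsub>Out torus\<^esub> \<longleftrightarrow> \<alpha> \<in> Inn torus"
    using N.rcos_const[OF AT.is_group, of \<alpha>]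
      AT.rcos_self[OF Aut_over_intD(1)[OF \<alpha>] N.subgroup_axioms]
    by (auto simp: out_class_def Out_def FactGroup_def)
  also have "\<dots> \<longleftrightarrow> out_class H (restr \<alpha>) \<in> generate (Out H) {out_class H \<phi>}"
  proof
    assume "\<alpha> \<in> Inn torus"
    then obtain h m where "h \<in> carrier H" "\<alpha> = inner_aut torus (h, m)"
      by (auto simp: Inn_def torus_simps)
    then show "out_class H (restr \<alpha>) \<in> generate (Out H) {out_class H \<phi>}"
      using restr_inner_class gen by blast
  next
    assume "out_class H (restr \<alpha>) \<in> generate (Out H) {out_class H \<phi>}"
    then obtain m :: int where m: "out_class H (restr \<alpha>) = out_class H \<phi> [^]\<^bsub>Out H\<^esub> m"
      using gen by auto
    \<comment> \<open>conjugation by \<open>t\<close> to the power \<open>- m\<close> restricts to \<open>\<phi>\<close> to the power \<open>m\<close>\<close>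
    let ?\<beta> = "inner_aut torus (\<one>, - m)"
    have \<beta>: "?\<beta> \<in> Aut_over_int" by (intro inner_aut_over_int) simp
    note rA = Aut_over_intD(3)[OF \<alpha>] Aut_over_intD(3)[OF \<beta>]
    have "out_class H (restr ?\<beta>) = out_class H (restr \<alpha>)"
      using restr_inner_class[of \<one> "- m"] m by simp
    then have "out_class H (restr \<alpha> \<otimes>\<^bsub>Aut H\<^esub> inv\<^bsub>Aut H\<^esub> restr ?\<beta>) = \<one>\<^bsub>Out H\<^esub>"
      using rA by simp
    then obtain h where h: "h \<in> carrier H"
      "restr \<alpha> \<otimes>\<^bsub>Aut H\<^esub> inv\<^bsub>Aut H\<^esub> restr ?\<beta> = inner_aut H h"
      using out_class_eq_oneD[OF is_group phi] rA by (metis A.inv_closed A.m_closed)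
    then have "restr \<alpha> = restr (inner_aut torus (h, 0)) \<otimes>\<^bsub>Aut H\<^esub> restr ?\<beta>"
      using rA by (metis A.inv_solve_right A.m_closed A.inv_closed inner_aut_in_Aut is_group restr_inner_aut_fibre)
    also have "\<dots> = restr (inner_aut torus (h, 0) \<otimes>\<^bsub>Aut torus\<^esub> ?\<beta>)"
      using h \<beta> by (simp add: restr_mult inner_aut_over_int)
    also have "inner_aut torus (h, 0) \<otimes>\<^bsub>Aut torus\<^esub> ?\<beta>
        = inner_aut torus ((h, 0) \<otimes>\<^bsub>torus\<^esub> (\<one>, - m))"
      using h by (simp add: inner_aut_mult[OF T.is_group])
    finally have "\<alpha> = inner_aut torus ((h, 0) \<otimes>\<^bsub>torus\<^esub> (\<one>, - m))"
      using h by (intro restr_inj[OF centre \<alpha>] inner_aut_over_int) auto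
    then show "\<alpha> \<in> Inn torus" using h by (simp add: Inn_def)
  qed
  finally show ?thesis .
qed

text \<open>Both groups are quotients of the group of automorphisms over \<open>\<int>\<close>: one by taking the outer class in
  the torus, the other by taking the outer class of the restriction to \<open>H\<close> modulo \<open>\<langle>\<phi>\<rangle>\<close>. The kernels
  coincide.\<close>

lemma Out0_iso:
  assumes centre: "centre H = {\<one>}"
  shows "(Out torus)\<lparr>carrier := Out0 H \<phi>\<rparr> \<cong>
    (Out H)\<lparr>carrier := centraliser (Out H) (out_class H \<phi>)\<rparr> Mod generate (Out H) {out_class H \<phi>}"
    (is "?O \<cong> ?C Mod ?N")
proof (rule iso_of_homs_with_equal_kernels)
  have cl: "out_class H \<phi> \<in> carrier (Out H)" by simp
  interpret N: normal ?N ?C by (rule O.generate_normal_centraliser[OF cl])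
  let ?q = "\<lambda>\<alpha>. ?N #>\<^bsub>?C\<^esub> out_class H (restr \<alpha>)"
  have O: "group ?O"
    by (rule subgroup.subgroup_is_group[OF Out0_subgroup[OF is_group phi] OT.is_group])
  show "group_hom AutZ ?O (out_class torus)"
    by (auto simp: group_hom_def group_hom_axioms_def group_AutZ O[unfolded Out0_eq] hom_def
        Out0_eq Aut_over_intD(1))
  show "out_class torus ` carrier AutZ = carrier ?O" by (simp add: Out0_eq)
  have "(\<lambda>\<alpha>. out_class H (restr \<alpha>)) \<in> hom AutZ ?C"
    by (auto simp: hom_def restr_centralises restr_mult Aut_over_intD(3))
  from Group.hom_compose[OF this N.r_coset_hom_Mod]
  show "group_hom AutZ (?C Mod ?N) ?q"
    by (simp add: group_hom_def group_hom_axioms_def group_AutZ N.factorgroup_is_group comp_def)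
  have "carrier (?C Mod ?N) = (\<lambda>c. ?N #>\<^bsub>?C\<^esub> c) ` centraliser (Out H) (out_class H \<phi>)"
    by (auto simp: FactGroup_def RCOSETS_def)
  then show "?q ` carrier AutZ = carrier (?C Mod ?N)"
    using image_image[of "\<lambda>c. ?N #>\<^bsub>?C\<^esub> c" "\<lambda>\<alpha>. out_class H (restr \<alpha>)" Aut_over_int]
    unfolding restr_onto_centraliser by simp
  have "out_class torus \<alpha> = \<one>\<^bsub>?O\<^esub> \<longleftrightarrow> ?q \<alpha> = \<one>\<^bsub>?C Mod ?N\<^esub>" if \<alpha>: "\<alpha> \<in> carrier AutZ" for \<alpha>
  proof -
    have "?q \<alpha> = ?N \<longleftrightarrow> out_class H (restr \<alpha>) \<in> ?N"
      using N.rcos_const[OF N.is_group, of "out_class H (restr \<alpha>)"]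
        N.rcos_self[OF _ N.subgroup_axioms, of "out_class H (restr \<alpha>)"]
        restr_centralises[of \<alpha>] \<alpha> by auto
    then show ?thesis using out_class_trivial_iff[OF centre] \<alpha> by (simp add: FactGroup_def)
  qed
  then show "kernel AutZ ?O (out_class torus) = kernel AutZ (?C Mod ?N) ?q"
    unfolding kernel_def by blast
qed

section \<open>The degree of an automorphism\<close>

definition degree :: "('a \<times> int \<Rightarrow> 'a \<times> int) \<Rightarrow> int" where
  "degree \<alpha> = snd (\<alpha> t)"

text \<open>The condition on the right is what an endomorphism that extends \<open>\<delta>\<close> and sends \<open>t\<close> to \<open>g t\<inverse>\<close> has to
  satisfy: it is the image \<open>g t\<inverse> \<delta>(k) = \<delta>(\<phi>(k)) g t\<inverse>\<close> of the defining relation, written in the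
  normal form of the torus. On automorphisms of \<open>H\<close>, composed from left to right, it says
  \<open>\<delta> \<phi>\<inverse> = \<phi> \<delta> \<gamma>\<^sub>g\<close>.\<close>

lemma conjugate_inverse_iff:
  assumes \<delta>: "\<delta> \<in> carrier (Aut H)"
  shows "inv\<^bsub>Out H\<^esub> (out_class H \<delta>) \<otimes>\<^bsub>Out H\<^esub> out_class H \<phi> \<otimes>\<^bsub>Out H\<^esub> out_class H \<delta>
      = inv\<^bsub>Out H\<^esub> (out_class H \<phi>) \<longleftrightarrow>
    (\<exists>g\<in>carrier H. \<forall>k\<in>carrier H. g \<otimes> (\<phi> [^]\<^bsub>Aut H\<^esub> (- 1::int)) (\<delta> k) = \<delta> (\<phi> k) \<otimes> g)"
    (is "?l \<longleftrightarrow> ?r")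
proof -
  let ?i = "inv\<^bsub>Aut H\<^esub> \<phi>"
  let ?\<psi> = "inv\<^bsub>Aut H\<^esub> (\<phi> \<otimes>\<^bsub>Aut H\<^esub> \<delta>) \<otimes>\<^bsub>Aut H\<^esub> (\<delta> \<otimes>\<^bsub>Aut H\<^esub> ?i)"
  have pow: "\<phi> [^]\<^bsub>Aut H\<^esub> (- 1::int) = ?i" by (simp add: A.int_pow_neg)
  have "?l \<longleftrightarrow> out_class H ?\<psi> = \<one>\<^bsub>Out H\<^esub>"
    using \<delta> by (auto simp: cls.hom_inv O.m_assoc O.inv_mult_group O.inv_solve_left')
  also have "\<dots> \<longleftrightarrow> (\<exists>g\<in>carrier H. ?\<psi> = inner_aut H g)"
    using \<delta> out_class_eq_oneD[OF is_group phi] out_class_eq_one[OF is_group phi]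
    by (metis A.inv_closed A.m_closed phi)
  also have "\<dots> \<longleftrightarrow> ?r"
  proof (rule bex_cong[OF refl])
    fix g assume g: "g \<in> carrier H"
    note in_Aut = \<delta> phi inner_aut_in_Aut[OF is_group g]
    have "?\<psi> = inner_aut H g \<longleftrightarrow>
        \<delta> \<otimes>\<^bsub>Aut H\<^esub> ?i = \<phi> \<otimes>\<^bsub>Aut H\<^esub> \<delta> \<otimes>\<^bsub>Aut H\<^esub> inner_aut H g" (is "_ \<longleftrightarrow> ?a = ?b")
      using in_Aut by (simp add: A.inv_solve_left')
    also have "?a = ?b \<longleftrightarrow> (\<forall>k\<in>carrier H. ?a k = ?b k)"
      using Aut_eqI[of ?a H ?b] in_Aut by auto
    also have "\<dots> \<longleftrightarrow> (\<forall>k\<in>carrier H. ?i (\<delta> k) = inv g \<otimes> \<delta> (\<phi> k) \<otimes> g)"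
      using in_Aut by (simp add: mult_Aut_apply Aut_closed) (simp add: inner_aut_def Aut_closed)
    also have "\<dots> \<longleftrightarrow> (\<forall>k\<in>carrier H. g \<otimes> ?i (\<delta> k) = \<delta> (\<phi> k) \<otimes> g)"
      using g \<delta> by (intro ball_cong refl) (auto simp: m_assoc inv_solve_left Aut_closed)
    finally show "?\<psi> = inner_aut H g \<longleftrightarrow>
        (\<forall>k\<in>carrier H. g \<otimes> (\<phi> [^]\<^bsub>Aut H\<^esub> (- 1::int)) (\<delta> k) = \<delta> (\<phi> k) \<otimes> g)"
      by (simp only: pow)
  qed
  finally show ?thesis .
qed

lemma reversing_Aut_ex:
  assumes "conjugate_in (Out H) (out_class H \<phi>) (inv\<^bsub>Out H\<^esub> (out_class H \<phi>))"
  shows "\<exists>\<alpha>\<in>carrier (Aut torus). degree \<alpha> = - 1"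
proof -
  obtain c where c: "c \<in> carrier (Out H)"
    "inv\<^bsub>Out H\<^esub> c \<otimes>\<^bsub>Out H\<^esub> out_class H \<phi> \<otimes>\<^bsub>Out H\<^esub> c = inv\<^bsub>Out H\<^esub> (out_class H \<phi>)"
    using assms unfolding conjugate_in_def by blast
  then obtain \<delta> where \<delta>: "\<delta> \<in> carrier (Aut H)" "c = out_class H \<delta>"
    using out_class_surj[of H] by blast
  then obtain g where g: "g \<in> carrier H"
    and rel: "\<And>k. k \<in> carrier H \<Longrightarrow> g \<otimes> (\<phi> [^]\<^bsub>Aut H\<^esub> (- 1::int)) (\<delta> k) = \<delta> (\<phi> k) \<otimes> g"
    using c(2) conjugate_inverse_iff[OF \<delta>(1)] by blast
  note closed = Aut_closed[OF \<delta>(1)] Aut_closed[OF phi]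
  have "(\<lambda>h. (\<delta> h, 0)) \<in> hom H torus"
    by (rule homI) (use closed Aut_mult[OF \<delta>(1)] in \<open>auto simp: torus_simps one_Aut\<close>)
  moreover have "(g, - 1) \<otimes>\<^bsub>torus\<^esub> (\<delta> h, 0) = (\<delta> (\<phi> h), 0) \<otimes>\<^bsub>torus\<^esub> (g, - 1)"
    if "h \<in> carrier H" for h
    using that rel[OF that] g by (simp add: torus_simps one_Aut)
  ultimately obtain \<alpha> where \<alpha>: "\<alpha> \<in> hom torus torus"
    "\<And>h. h \<in> carrier H \<Longrightarrow> \<alpha> (h, 0) = (\<delta> h, 0)" "\<alpha> t = (g, - 1)"
    using torus_hom_ex[OF T.is_group, of "\<lambda>h. (\<delta> h, 0)" "(g, - 1)"] g by auto
  then have "restrict \<alpha> (carrier torus) \<in> carrier (Aut torus)"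
    by (intro restrict_torus_hom_Aut[OF \<alpha>(1) \<delta>(1)]) auto
  moreover have "degree (restrict \<alpha> (carrier torus)) = - 1" using \<alpha>(3) by (simp add: degree_def)
  ultimately show ?thesis by blast
qed

text \<open>Membership can be tested on any representative because all inner automorphisms of the torus
  induce the identity on \<open>\<int>\<close>.\<close>

lemma out_class_in_Out0_iff:
  assumes \<alpha>: "\<alpha> \<in> carrier (Aut torus)"
  shows "out_class torus \<alpha> \<in> Out0 H \<phi> \<longleftrightarrow> \<alpha> \<in> Aut_over_int"
proof
  interpret N: normal "Inn torus" "Aut torus" by (rule Inn_normal[OF T.is_group])
  interpret S: subgroup Aut_over_int "Aut torus" by (rule subgroup_Aut_over_int)
  assume "out_class torus \<alpha> \<in> Out0 H \<phi>"
  then obtain \<beta> where \<beta>: "\<beta> \<in> Aut_over_int" "Inn torus #>\<^bsub>Aut torus\<^esub> \<alpha> = Inn torus #>\<^bsub>Aut torus\<^esub> \<beta>"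
    by (auto simp: Out0_eq out_class_def)
  then have "\<alpha> \<in> Inn torus #>\<^bsub>Aut torus\<^esub> \<beta>"
    using AT.rcos_self[OF \<alpha> N.subgroup_axioms] by simp
  then obtain x where "x \<in> carrier torus" "\<alpha> = inner_aut torus x \<otimes>\<^bsub>Aut torus\<^esub> \<beta>"
    by (auto simp: r_coset_def Inn_def)
  then show "\<alpha> \<in> Aut_over_int" using \<beta>(1) inner_aut_over_int S.m_closed by simp
qed (simp add: Out0_eq)

end

locale group_with_automorphism_no_epi = group_with_automorphism +
  assumes no_epi: "epi H integer_group = {}"
begin

text \<open>Without epimorphisms from \<open>H\<close> onto \<open>\<int>\<close>, every homomorphism from \<open>H\<close> to \<open>\<int>\<close> vanishes, so each
  automorphism of the torus preserves \<open>H\<close> and induces a map on \<open>\<int>\<close>, which is multiplication by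
  the degree.\<close>

lemma snd_Aut:
  assumes \<alpha>: "\<alpha> \<in> carrier (Aut torus)" and x: "x \<in> carrier torus"
  shows "snd (\<alpha> x) = degree \<alpha> * snd x"
proof -
  interpret \<alpha>: group_hom torus torus \<alpha> by (rule Aut_group_hom[OF \<alpha>])
  interpret snd: group_hom torus integer_group snd by (rule snd_hom)
  have "(\<lambda>h. snd (\<alpha> (h, 0))) \<in> hom H integer_group"
  proof (rule homI)
    fix h k assume hk: "h \<in> carrier H" "k \<in> carrier H"
    have "\<alpha> (h \<otimes> k, 0) = \<alpha> ((h, 0) \<otimes>\<^bsub>torus\<^esub> (k, 0))"
      using hk by (simp add: torus_simps one_Aut)
    then show "snd (\<alpha> (h \<otimes> k, 0)) = snd (\<alpha> (h, 0)) \<otimes>\<^bsub>integer_group\<^esub> snd (\<alpha> (k, 0))"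
      using hk by (simp add: snd_mult_torus)
  qed simp
  then have fib: "snd (\<alpha> (h, 0)) = 0" if "h \<in> carrier H" for h
    using hom_integer_group_eq_0[OF is_group no_epi _ that, of "\<lambda>h. snd (\<alpha> (h, 0))"] by simp
  obtain h m where h: "x = (h, m)" "h \<in> carrier H" using x by (cases x) (auto simp: torus_simps)
  then have "\<alpha> x = \<alpha> (h, 0) \<otimes>\<^bsub>torus\<^esub> \<alpha> t [^]\<^bsub>torus\<^esub> m"
    by (simp add: torus_decomp[OF is_group phi, of h m] \<alpha>.hom_int_pow)
  then show ?thesis using h fib by (simp add: snd_mult_torus snd.hom_int_pow degree_def)
qed

lemma degree_cases:
  assumes \<alpha>: "\<alpha> \<in> carrier (Aut torus)" shows "degree \<alpha> = 1 \<or> degree \<alpha> = - 1"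
proof -
  have "t \<in> \<alpha> ` carrier torus" using \<alpha> t_in_torus by (simp add: Aut_iff bij_betw_def)
  then obtain x where "x \<in> carrier torus" "\<alpha> x = t" by auto
  then have "degree \<alpha> * snd x = 1" using snd_Aut[OF \<alpha>, of x] by simp
  then show ?thesis by (auto simp: zmult_eq_1_iff)
qed

lemma Aut_over_int_iff:
  assumes "\<alpha> \<in> carrier (Aut torus)" shows "\<alpha> \<in> Aut_over_int \<longleftrightarrow> degree \<alpha> = 1"
proof -
  have "\<alpha> \<in> Aut_over_int \<longleftrightarrow> (\<forall>x\<in>carrier torus. degree \<alpha> * snd x = snd x)"
    using assms by (simp add: Aut_over_int_def snd_Aut)
  then show ?thesis using t_in_torus by fastforce
qed

lemma degree_mult:
  assumes \<alpha>: "\<alpha> \<in> carrier (Aut torus)" and \<beta>: "\<beta> \<in> carrier (Aut torus)"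
  shows "degree (\<alpha> \<otimes>\<^bsub>Aut torus\<^esub> \<beta>) = degree \<alpha> * degree \<beta>"
  using snd_Aut[OF \<beta> Aut_closed[OF \<alpha> t_in_torus]]
  by (simp add: degree_def mult_Aut_apply[OF \<alpha> \<beta>])

text \<open>Degree \<open>-1\<close> means \<open>\<alpha>(t) = g t\<inverse>\<close> for some \<open>g\<close>, and applying \<open>\<alpha>\<close> to \<open>t k = \<phi>(k) t\<close> gives the
  relation that characterises conjugacy of the class of \<open>\<phi>\<close> with its inverse; the conjugating
  element is the class of the restriction of \<open>\<alpha>\<close> to \<open>H\<close>.\<close>

lemma conjugate_inverse_if_reversing:
  assumes \<alpha>: "\<alpha> \<in> carrier (Aut torus)" and deg: "degree \<alpha> = - 1"
  shows "conjugate_in (Out H) (out_class H \<phi>) (inv\<^bsub>Out H\<^esub> (out_class H \<phi>))"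
proof -
  have "snd (\<alpha> x) = 0 \<longleftrightarrow> snd x = 0" if "x \<in> carrier torus" for x
    using snd_Aut[OF \<alpha> that] deg by simp
  then have r: "restr \<alpha> \<in> carrier (Aut H)"
    "\<And>h. h \<in> carrier H \<Longrightarrow> \<alpha> (h, 0) = (restr \<alpha> h, 0)"
    using restr_in_Aut[of \<alpha>] \<alpha> by blast+
  obtain g where g: "\<alpha> t = (g, - 1)" "g \<in> carrier H"
    using deg Aut_closed[OF \<alpha> t_in_torus] by (cases "\<alpha> t") (auto simp: degree_def torus_simps)
  have "g \<otimes> (\<phi> [^]\<^bsub>Aut H\<^esub> (- 1::int)) (restr \<alpha> k) = restr \<alpha> (\<phi> k) \<otimes> g" if k: "k \<in> carrier H" for k
  proof -
    have \<phi>k: "\<phi> k \<in> carrier H" using k by (simp add: Aut_closed)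
    have "t \<otimes>\<^bsub>torus\<^esub> (k, 0) = (\<phi> k, 0) \<otimes>\<^bsub>torus\<^esub> t"
      using k \<phi>k by (simp add: torus_simps one_Aut)
    then have "\<alpha> t \<otimes>\<^bsub>torus\<^esub> \<alpha> (k, 0) = \<alpha> (\<phi> k, 0) \<otimes>\<^bsub>torus\<^esub> \<alpha> t"
      using Aut_mult[OF \<alpha> t_in_torus fibre_in_torus[OF k, of 0]]
        Aut_mult[OF \<alpha> fibre_in_torus[OF \<phi>k, of 0] t_in_torus] by simp
    then show ?thesis
      using k \<phi>k g Aut_closed[OF r(1)] by (simp add: r(2) torus_simps one_Aut)
  qed
  then show ?thesis
    using conjugate_inverse_iff[OF r(1)] g(2) r(1) unfolding conjugate_in_def
    by (metis cls.hom_closed)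
qed

lemma Out0_index:
  assumes "conjugate_in (Out H) (out_class H \<phi>) (inv\<^bsub>Out H\<^esub> (out_class H \<phi>))"
  shows "card (rcosets\<^bsub>Out torus\<^esub> Out0 H \<phi>) = 2"
proof -
  obtain \<alpha> where \<alpha>: "\<alpha> \<in> carrier (Aut torus)" "degree \<alpha> = - 1"
    using reversing_Aut_ex[OF assms] by blast
  have "degree \<one>\<^bsub>Aut torus\<^esub> = 1" using t_in_torus by (simp add: degree_def one_Aut)
  then have inv: "degree (inv\<^bsub>Aut torus\<^esub> \<alpha>) = - 1"
    using degree_mult[OF AT.inv_closed[OF \<alpha>(1)] \<alpha>(1)] \<alpha> by simp
  show ?thesis
  proof (rule OT.card_rcosets_eq_2[OF Out0_subgroup[OF is_group phi]])
    show "out_class torus \<alpha> \<in> carrier (Out torus)" using \<alpha> by simp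
    show "out_class torus \<alpha> \<notin> Out0 H \<phi>"
      using \<alpha> by (simp add: out_class_in_Out0_iff Aut_over_int_iff)
    fix c assume c: "c \<in> carrier (Out torus)" "c \<notin> Out0 H \<phi>"
    then obtain \<beta> where \<beta>: "\<beta> \<in> carrier (Aut torus)" "c = out_class torus \<beta>"
      using out_class_surj[of torus] by blast
    then have "degree \<beta> = - 1"
      using c degree_cases[OF \<beta>(1)] by (auto simp: out_class_in_Out0_iff Aut_over_int_iff)
    then have "\<beta> \<otimes>\<^bsub>Aut torus\<^esub> inv\<^bsub>Aut torus\<^esub> \<alpha> \<in> Aut_over_int"
      using \<alpha> \<beta> inv by (simp add: Aut_over_int_iff degree_mult)
    moreover have "c \<otimes>\<^bsub>Out torus\<^esub> inv\<^bsub>Out torus\<^esub> out_class torus \<alpha>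
        = out_class torus (\<beta> \<otimes>\<^bsub>Aut torus\<^esub> inv\<^bsub>Aut torus\<^esub> \<alpha>)"
      using \<alpha> \<beta> by simp
    ultimately show "c \<otimes>\<^bsub>Out torus\<^esub> inv\<^bsub>Out torus\<^esub> out_class torus \<alpha> \<in> Out0 H \<phi>"
      by (simp add: Out0_eq)
  qed
qed

lemma Out0_eq_Out_or_conjugate:
  "Out0 H \<phi> = carrier (Out torus) \<or>
    conjugate_in (Out H) (out_class H \<phi>) (inv\<^bsub>Out H\<^esub> (out_class H \<phi>))"
proof (cases "\<exists>\<alpha>\<in>carrier (Aut torus). degree \<alpha> = - 1")
  case False
  then have "carrier (Aut torus) \<subseteq> Aut_over_int" using degree_cases Aut_over_int_iff by blast
  then have "Aut_over_int = carrier (Aut torus)" using Aut_over_intD(1) by blast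
  then show ?thesis by (simp add: Out0_eq out_class_surj)
qed (use conjugate_inverse_if_reversing in blast)

end

section \<open>The outer automorphism group of a mapping torus\<close>

theorem theorem2p6:
  fixes H :: "('a, 'b) monoid_scheme" and \<phi> :: "'a \<Rightarrow> 'a"
  assumes "group H"
    and "centre H = {\<one>\<^bsub>H\<^esub>}"
    and "epi H integer_group = {}"
    and "\<phi> \<in> carrier (Aut H)"
  shows "(Out (mapping_torus H \<phi>))\<lparr>carrier := Out0 H \<phi>\<rparr> \<cong>
      (Out H)\<lparr>carrier := centraliser (Out H) (out_class H \<phi>)\<rparr>
        Mod generate (Out H) {out_class H \<phi>} \<and>
    (Out0 H \<phi> = carrier (Out (mapping_torus H \<phi>)) \<or>
      conjugate_in (Out H) (out_class H \<phi>) (inv\<^bsub>Out H\<^esub> (out_class H \<phi>))) \<and>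
    (conjugate_in (Out H) (out_class H \<phi>) (inv\<^bsub>Out H\<^esub> (out_class H \<phi>)) \<longrightarrow>
      card (rcosets\<^bsub>Out (mapping_torus H \<phi>)\<^esub> Out0 H \<phi>) = 2)"
proof -
  interpret group_with_automorphism_no_epi H \<phi>
    using assms by (simp add: group_with_automorphism_no_epi_def group_with_automorphism_def
        group_with_automorphism_axioms_def group_with_automorphism_no_epi_axioms_def)
  show ?thesis
    using Out0_iso[OF assms(2)] Out0_eq_Out_or_conjugate Out0_index by blast
qed

end
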